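(* Let $H\in\mathbb{R}^{n\times n}$ be symmetric positive semi-definite, and let $\mathcal{S}(H)$ be the set of symmetric positive semi-definite $\tilde H\in\mathbb{R}^{n\times n}$ having the same eigenvalues as $H$, counted with multiplicity. Then $$\sup_{\tilde H\in\mathcal{S}(H)}\mathcal{L}_{\mathrm{worst}}(\mathsf{LDLQ},\tilde H)=\mathcal{L}_{\mathrm{worst}}(\mathsf{Stoch},H)=\tfrac{m}{4}\operatorname{tr}(H).$$ Moreover, if $\mathsf{LDLQ}$ uses nearest rounding as its subroutine $\mathcal{Q}$ (resp. stochastic rounding), then $$\sup_{\tilde H\in\mathcal{S}(H)}\mathcal{L}_{\mathrm{avg}}(\mathsf{LDLQ},\tilde H)=\mathcal{L}_{\mathrm{avg}}(\mathcal{B},H)=\tfrac{m}{c}\operatorname{tr}(H),$$ with $\mathcal{B}=\mathsf{Near}$ and $c=12$ (resp. $\mathcal{B}=\mathsf{Stoch}$ and $c=6$).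
   Context: Nearest rounding maps $z$ to a nearest integer. Unbiased stochastic rounding maps $z$ to $\lfloor z\rfloor+1$ with probability $z-\lfloor z\rfloor$ and to $\lfloor z\rfloor$ otherwise, independently each time. $\mathsf{LDLQ}$, with rounding subroutine $\mathcal{Q}$ applied entrywise, works as follows: given $W\in\mathbb{R}^{m\times n}$ and $H$ with LDL decomposition $H=(\grave U+I)D(\grave U+I)^T$ ($\grave U$ strictly upper triangular, $D$ nonnegative diagonal), compute for $k=1,\dots,n$ the column $\hat W_k=\mathcal{Q}(W_k+(W-\hat W)\grave U_k)$, where $X_k$ is the $k$-th column of $X$. $\mathsf{Near}$ / $\mathsf{Stoch}$ apply nearest / stochastic rounding entrywise to $W$. Proxy losses: $\mathcal{L}_{\mathrm{worst}}(\mathcal{A},H)=\sup_{W\in\mathbb{R}^{m\times n}}\mathbb{E}[\operatorname{tr}((\mathcal{A}(W,H)-W)H(\mathcal{A}(W,H)-W)^T)]$ and $\mathcal{L}_{\mathrm{avg}}(\mathcal{A},H)=\mathbb{E}_{W\sim\mathrm{Unif}[0,1]^{m\times n}}[\operatorname{tr}((\mathcal{A}(W,H)-W)H(\mathcal{A}(W,H)-W)^T)]$, with expectation over the rounding randomness (and over $W$). *)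

theory Defs
  imports "Jordan_Normal_Form.Char_Poly" "HOL-Probability.Probability"
begin

definition mtrace :: "real mat \<Rightarrow> real" where
  "mtrace A = (\<Sum>i<dim_row A. A $$ (i,i))"

definition sym_psd :: "real mat \<Rightarrow> bool" where
  "sym_psd H \<longleftrightarrow> H \<in> carrier_mat (dim_row H) (dim_row H) \<and> transpose_mat H = H \<and>
     (\<forall>x \<in> carrier_vec (dim_row H). 0 \<le> x \<bullet> (H *\<^sub>v x))"

definition eig_mult :: "real mat \<Rightarrow> real \<Rightarrow> nat" where
  "eig_mult A lam = order lam (char_poly A)"

definition same_spectrum_psd :: "real mat \<Rightarrow> real mat set" where
  "same_spectrum_psd H = {Ht. sym_psd Ht \<and> dim_row Ht = dim_row H \<and>
      (\<forall>lam. eig_mult Ht lam = eig_mult H lam)}"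

definition ldl_decomp :: "real mat \<Rightarrow> real mat \<Rightarrow> real mat \<Rightarrow> bool" where
  "ldl_decomp H U D \<longleftrightarrow> (let n = dim_row H in
     H \<in> carrier_mat n n \<and> U \<in> carrier_mat n n \<and> D \<in> carrier_mat n n \<and>
     (\<forall>i<n. \<forall>j<n. j \<le> i \<longrightarrow> U $$ (i,j) = 0) \<and>
     diagonal_mat D \<and> (\<forall>i<n. 0 \<le> D $$ (i,i)) \<and>
     H = (U + 1\<^sub>m n) * D * transpose_mat (U + 1\<^sub>m n))"

definition ldl_U :: "real mat \<Rightarrow> real mat" where
  "ldl_U H = fst (SOME (U, D). ldl_decomp H U D)"

text \<open>A rounding subroutine takes an auxiliary random number u \<in> [0,1] and z.
  Nearest rounding ignores u (ties rounded up); stochastic rounding rounds up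
  iff u < z - floor z, i.e. with probability z - floor z when u ~ Unif[0,1].\<close>
definition near_round :: "real \<Rightarrow> real \<Rightarrow> real" where
  "near_round u z = real_of_int \<lfloor>z + 1/2\<rfloor>"

definition stoch_round :: "real \<Rightarrow> real \<Rightarrow> real" where
  "stoch_round u z = (if u < z - real_of_int \<lfloor>z\<rfloor> then real_of_int \<lfloor>z\<rfloor> + 1 else real_of_int \<lfloor>z\<rfloor>)"

text \<open>An algorithm maps (W, H, randomness u) to the quantized matrix; u assigns an
  independent Unif[0,1] number to each entry (i,k).\<close>

definition entrywise :: "(real \<Rightarrow> real \<Rightarrow> real) \<Rightarrow> real mat \<Rightarrow> real mat \<Rightarrow> (nat \<times> nat \<Rightarrow> real) \<Rightarrow> real mat" where
  "entrywise Q W H u = Matrix.mat (dim_row W) (dim_col W) (\<lambda>(i,k). Q (u (i,k)) (W $$ (i,k)))"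

text \<open>One row of LDLQ: the first k quantized entries. Entry k is
  Q_k (w_k + sum_{j<k} (w_j - what_j) U_{jk}); since U is strictly upper triangular
  this is exactly the k-th entry of W_k + (W - What) U_k.\<close>
primrec ldlq_row :: "(nat \<Rightarrow> real \<Rightarrow> real) \<Rightarrow> (nat \<Rightarrow> real) \<Rightarrow> real mat \<Rightarrow> nat \<Rightarrow> real list" where
  "ldlq_row Q w U 0 = []"
| "ldlq_row Q w U (Suc k) = (let prev = ldlq_row Q w U k in
     prev @ [Q k (w k + (\<Sum>j<k. (w j - prev ! j) * U $$ (j,k)))])"

definition LDLQ :: "(real \<Rightarrow> real \<Rightarrow> real) \<Rightarrow> real mat \<Rightarrow> real mat \<Rightarrow> (nat \<times> nat \<Rightarrow> real) \<Rightarrow> real mat" where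
  "LDLQ Q W H u = (let U = ldl_U H; n = dim_col W in
     Matrix.mat (dim_row W) n (\<lambda>(i,k).
       ldlq_row (\<lambda>k'. Q (u (i,k'))) (\<lambda>j. W $$ (i,j)) U n ! k))"

definition unif01 :: "real measure" where
  "unif01 = uniform_measure lborel {0..1}"

definition unif_cube :: "nat \<Rightarrow> nat \<Rightarrow> (nat \<times> nat \<Rightarrow> real) measure" where
  "unif_cube m n = PiM ({0..<m} \<times> {0..<n}) (\<lambda>_. unif01)"

definition proxy :: "real mat \<Rightarrow> real mat \<Rightarrow> real mat \<Rightarrow> real" where
  "proxy What W H = mtrace ((What - W) * H * transpose_mat (What - W))"

type_synonym algo = "real mat \<Rightarrow> real mat \<Rightarrow> (nat \<times> nat \<Rightarrow> real) \<Rightarrow> real mat"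

definition L_worst :: "algo \<Rightarrow> nat \<Rightarrow> real mat \<Rightarrow> ereal" where
  "L_worst A m H = (SUP W \<in> carrier_mat m (dim_row H).
      ereal (\<integral>u. proxy (A W H u) W H \<partial>(unif_cube m (dim_row H))))"

definition L_avg :: "algo \<Rightarrow> nat \<Rightarrow> real mat \<Rightarrow> real" where
  "L_avg A m H = (let n = dim_row H in
     \<integral>w. (\<integral>u. proxy (A (Matrix.mat m n w) H u) (Matrix.mat m n w) H \<partial>(unif_cube m n)) \<partial>(unif_cube m n))"

end

theory Submission
  imports Defs "Jordan_Normal_Form.Schur_Decomposition"
begin

text \<open>
  With \<open>H = (U + I) D (U + I)\<^sup>T\<close>, the loss of LDLQ is the sum of \<open>D\<^sub>k \<eta>\<^sub>i\<^sub>k\<^sup>2\<close>, where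
  \<open>\<eta>\<^sub>i\<^sub>k\<close> is the error of a single rounding. The mean square of \<open>\<eta>\<^sub>i\<^sub>k\<close> is at most \<open>1/4\<close> in the
  worst case. For uniform weights it is exactly the constant of the rounding routine, since the number
  being rounded is uniform modulo 1 given the earlier entries of its row. As \<open>tr D \<le> tr H\<close>,
  and the trace depends only on the spectrum, this bounds the suprema. They are attained at a
  diagonal matrix of eigenvalues, where LDLQ loses exactly as much as entrywise rounding. For
  entrywise rounding, independent centered errors leave only the diagonal of \<open>H\<close>.
\<close>

unbundle no vec_syntax and no inner_syntax

subsection \<open>Quadratic forms and LDL factors\<close>

definition quad_form :: "nat \<Rightarrow> (nat \<Rightarrow> nat \<Rightarrow> 'a::comm_semiring_0) \<Rightarrow> (nat \<Rightarrow> 'a) \<Rightarrow> 'a" where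
  "quad_form n h f = (\<Sum>i<n. \<Sum>j<n. f i * h i j * f j)"

definition psd_form :: "nat \<Rightarrow> (nat \<Rightarrow> nat \<Rightarrow> 'a::linordered_field) \<Rightarrow> bool" where
  "psd_form n h \<longleftrightarrow> (\<forall>i<n. \<forall>j<n. h i j = h j i) \<and> (\<forall>f. 0 \<le> quad_form n h f)"

lemma quad_form_cong:
  assumes "\<And>i j. i < n \<Longrightarrow> j < n \<Longrightarrow> h i j = h' i j" "\<And>i. i < n \<Longrightarrow> f i = f' i"
  shows "quad_form n h f = quad_form n h' f'"
  unfolding quad_form_def using assms by (intro sum.cong refl) simp

lemma quad_form_unit:
  fixes h :: "nat \<Rightarrow> nat \<Rightarrow> 'a::comm_semiring_1"
  assumes "i < n"
  shows "quad_form n h (\<lambda>k. of_bool (k = i)) = h i i"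
proof -
  have "(\<Sum>j<n. of_bool (k = i) * h k j * of_bool (j = i)) = (if k = i then h i i else 0)" for k
    using assms by (simp add: of_bool_def if_distrib[where f = "\<lambda>x. _ * x"] cong: if_cong)
  then show ?thesis
    using assms by (simp add: quad_form_def)
qed

lemma psd_form_diag_nonneg:
  assumes "psd_form n h" "i < n"
  shows "0 \<le> h i i"
proof -
  have "0 \<le> quad_form n h (\<lambda>k. of_bool (k = i))"
    using assms(1) by (simp add: psd_form_def)
  then show ?thesis
    using assms(2) by (simp add: quad_form_unit)
qed

lemma quad_form_Suc:
  fixes h :: "nat \<Rightarrow> nat \<Rightarrow> 'a::comm_ring_1"
  assumes "\<And>i. i < n \<Longrightarrow> h n i = h i n"
  shows "quad_form (Suc n) h f =
    quad_form n h f + 2 * f n * (\<Sum>i<n. f i * h i n) + h n n * (f n)\<^sup>2"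
proof -
  have "(\<Sum>j<n. f n * h n j * f j) = f n * (\<Sum>i<n. f i * h i n)"
    using assms by (auto simp: sum_distrib_left intro!: sum.cong)
  moreover have "(\<Sum>i<n. f i * h i n * f n) = f n * (\<Sum>i<n. f i * h i n)"
    by (simp add: sum_distrib_left mult_ac)
  ultimately show ?thesis
    by (simp add: quad_form_def sum.distrib power2_eq_square mult_ac)
qed

lemma psd_form_Suc_nonneg:
  assumes "psd_form (Suc n) h"
  shows "0 \<le> quad_form n h f + 2 * s * (\<Sum>i<n. f i * h i n) + h n n * s\<^sup>2"
proof -
  have "0 \<le> quad_form (Suc n) h (f(n := s))"
    using assms by (simp add: psd_form_def)
  also have "\<dots> = quad_form n h (f(n := s)) + 2 * s * (\<Sum>i<n. (f(n := s)) i * h i n) + h n n * s\<^sup>2"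
    using assms by (subst quad_form_Suc) (auto simp: psd_form_def)
  also have "quad_form n h (f(n := s)) = quad_form n h f"
    by (simp add: quad_form_def)
  finally show ?thesis by simp
qed

lemma psd_form_zero_pivot:
  assumes psd: "psd_form (Suc n) h" and "h n n = 0" "i < n"
  shows "h i n = 0"
proof (rule ccontr)
  assume "h i n \<noteq> 0"
  have "0 \<le> h i i + 2 * s * h i n" for s
    using psd_form_Suc_nonneg[OF psd, of "\<lambda>k. of_bool (k = i)" s] assms(2,3)
    by (simp add: quad_form_unit)
  from this[of "- (h i i + 1) / (2 * h i n)"] show False
    using \<open>h i n \<noteq> 0\<close> by (simp add: field_simps)
qed

definition schur_complement :: "nat \<Rightarrow> (nat \<Rightarrow> nat \<Rightarrow> 'a::field) \<Rightarrow> nat \<Rightarrow> nat \<Rightarrow> 'a" where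
  "schur_complement n h i j = h i j - h i n * h j n / h n n"

lemma quad_form_schur_complement:
  "quad_form n (schur_complement n h) f = quad_form n h f - (\<Sum>i<n. f i * h i n)\<^sup>2 / h n n"
proof -
  have "(\<Sum>i<n. f i * h i n)\<^sup>2 / h n n = (\<Sum>i<n. \<Sum>j<n. f i * (h i n * h j n / h n n) * f j)"
    by (simp add: power2_eq_square sum_product sum_divide_distrib mult_ac)
  then show ?thesis
    by (simp add: quad_form_def schur_complement_def algebra_simps sum_subtractf)
qed

lemma psd_form_schur_complement:
  assumes "psd_form (Suc n) h"
  shows "psd_form n (schur_complement n h)"
  unfolding psd_form_def
proof (intro conjI allI impI)
  fix i j assume "i < n" "j < n"
  then show "schur_complement n h i j = schur_complement n h j i"
    using assms by (simp add: schur_complement_def psd_form_def mult.commute)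
next
  fix f
  let ?b = "\<Sum>i<n. f i * h i n"
  have "0 \<le> quad_form n h f + 2 * (- ?b / h n n) * ?b + h n n * (- ?b / h n n)\<^sup>2"
    by (rule psd_form_Suc_nonneg[OF assms])
  also have "\<dots> = quad_form n h f - ?b\<^sup>2 / h n n"
    by (cases "h n n = 0") (simp_all add: field_simps power2_eq_square)
  finally show "0 \<le> quad_form n (schur_complement n h) f"
    by (simp only: quad_form_schur_complement)
qed

definition ldl_factors ::
  "nat \<Rightarrow> (nat \<Rightarrow> nat \<Rightarrow> 'a::linordered_field) \<Rightarrow> (nat \<Rightarrow> nat \<Rightarrow> 'a) \<Rightarrow> (nat \<Rightarrow> 'a) \<Rightarrow> bool" where
  "ldl_factors n h V d \<longleftrightarrow>
    (\<forall>k<n. 0 \<le> d k) \<and> (\<forall>i<n. V i i = 1) \<and> (\<forall>i<n. \<forall>j<i. V i j = 0) \<and>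
    (\<forall>i<n. \<forall>j<n. h i j = (\<Sum>l<n. V i l * d l * V j l))"

text \<open>Elimination starts from the last index because the unit factor is upper triangular. If the pivot
  \<open>h n n\<close> vanishes, then so does its column, and \<open>x / 0 = 0\<close> makes the formulas cover this case.\<close>

lemma ldl_factors_Suc:
  assumes psd: "psd_form (Suc n) h" and ldl: "ldl_factors n (schur_complement n h) V d"
  defines "V' \<equiv> \<lambda>i l. if l = n then if i = n then 1 else h i n / h n n else if i = n then 0 else V i l"
  shows "ldl_factors (Suc n) h V' (d(n := h n n))"
proof -
  let ?d = "d(n := h n n)"
  have pivot: "h i n / h n n * h n n = h i n" if "i < n" for i
    using psd_form_zero_pivot[OF psd _ that] by (cases "h n n = 0") simp_all
  have sym: "h n i = h i n" if "i < n" for i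
    using psd that by (simp add: psd_form_def)
  have split: "(\<Sum>l<Suc n. V' i l * ?d l * V' j l)
      = (\<Sum>l<n. V' i l * d l * V' j l) + V' i n * h n n * V' j n" for i j
    by simp
  have "h i j = (\<Sum>l<Suc n. V' i l * ?d l * V' j l)" if "i < Suc n" "j < Suc n" for i j
  proof -
    consider "i < n" "j < n" | "i < n" "j = n" | "i = n" "j < n" | "i = n" "j = n"
      using \<open>i < Suc n\<close> \<open>j < Suc n\<close> by linarith
    then show ?thesis
    proof cases
      case 1
      then have "(\<Sum>l<n. V' i l * d l * V' j l) = schur_complement n h i j"
        using ldl by (simp add: ldl_factors_def V'_def)
      moreover have "V' i n * h n n * V' j n = h i n * h j n / h n n"
        using 1 pivot[of i] by (simp add: V'_def)
      ultimately show ?thesis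
        unfolding split by (simp add: schur_complement_def)
    qed (use pivot sym in \<open>simp_all add: V'_def mult.commute\<close>)
  qed
  moreover have "0 \<le> ?d k" if "k < Suc n" for k
    using ldl psd_form_diag_nonneg[OF psd, of n] that by (auto simp: ldl_factors_def)
  moreover have "V' i i = 1" if "i < Suc n" for i
    using ldl that by (simp add: ldl_factors_def V'_def)
  moreover have "V' i j = 0" if "i < Suc n" "j < i" for i j
    using ldl that by (simp add: ldl_factors_def V'_def)
  ultimately show ?thesis
    unfolding ldl_factors_def by blast
qed

lemma psd_form_imp_ldl_factors:
  assumes "psd_form n h"
  shows "\<exists>V d. ldl_factors n h V d"
  using assms
proof (induction n arbitrary: h)
  case 0
  show ?case by (simp add: ldl_factors_def)
next
  case (Suc n)
  then obtain V d where "ldl_factors n (schur_complement n h) V d"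
    using psd_form_schur_complement by blast
  from ldl_factors_Suc[OF Suc.prems this] show ?case by blast
qed

lemma ldl_factors_diag_le:
  assumes "ldl_factors n h V d" "k < n"
  shows "d k \<le> h k k"
proof -
  have "V k k * d k * V k k \<le> (\<Sum>l<n. V k l * d l * V k l)"
  proof (rule member_le_sum)
    fix l assume "l \<in> {..<n} - {k}"
    then have "0 \<le> d l * (V k l)\<^sup>2"
      using assms(1) by (simp add: ldl_factors_def)
    then show "0 \<le> V k l * d l * V k l"
      by (simp add: power2_eq_square mult_ac)
  qed (use assms(2) in auto)
  then show ?thesis
    using assms by (simp add: ldl_factors_def)
qed

text \<open>The factors of a singular form are not unique: columns of \<open>V\<close> belonging to zero pivots are
  arbitrary.\<close>

lemma ldl_factors_diagonal:
  assumes ldl: "ldl_factors n h V d" and diag: "\<And>i j. i < n \<Longrightarrow> j < n \<Longrightarrow> i \<noteq> j \<Longrightarrow> h i j = 0"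
    and "k < n"
  shows "d k = h k k \<and> (\<forall>j<k. d k = 0 \<or> V j k = 0)"
  using \<open>k < n\<close>
proof (induction "n - k" arbitrary: k rule: less_induct)
  case less
  have column: "h j k = V j k * d k" if "j \<le> k" for j
  proof -
    have "V j l * d l * V k l = 0" if "l < n" "l \<noteq> k" for l
    proof (cases "l < k")
      case True
      then show ?thesis using ldl less.prems by (simp add: ldl_factors_def)
    next
      case False
      then have "k < l" "n - l < n - k" using that by auto
      with less.hyps[of l] have "d l = 0 \<or> V k l = 0"
        using \<open>l < n\<close> by blast
      then show ?thesis by auto
    qed
    then have "(\<Sum>l<n. V j l * d l * V k l) = (\<Sum>l\<in>{k}. V j l * d l * V k l)"
      using less.prems by (intro sum.mono_neutral_right) simp_all
    then show ?thesis
      using ldl less.prems that by (simp add: ldl_factors_def)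
  qed
  have "d k = 0 \<or> V j k = 0" if "j < k" for j
    using column[of j] diag[of j k] that less.prems by auto
  moreover have "d k = h k k"
    using column[of k] ldl less.prems by (simp add: ldl_factors_def)
  ultimately show ?case by blast
qed

lemma ldl_factors_quad_form:
  assumes ldl: "ldl_factors n h V d"
  shows "quad_form n h e = (\<Sum>k<n. d k * (e k + (\<Sum>j<k. e j * V j k))\<^sup>2)"
proof -
  have "quad_form n h e = (\<Sum>i<n. \<Sum>j<n. \<Sum>k<n. d k * ((e i * V i k) * (e j * V j k)))"
    using ldl unfolding quad_form_def ldl_factors_def
    by (intro sum.cong refl) (simp add: sum_distrib_left sum_distrib_right mult_ac)
  also have "\<dots> = (\<Sum>i<n. \<Sum>k<n. \<Sum>j<n. d k * ((e i * V i k) * (e j * V j k)))"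
    by (intro sum.cong refl sum.swap)
  also have "\<dots> = (\<Sum>k<n. \<Sum>i<n. \<Sum>j<n. d k * ((e i * V i k) * (e j * V j k)))"
    by (rule sum.swap)
  also have "\<dots> = (\<Sum>k<n. d k * (\<Sum>i<n. e i * V i k)\<^sup>2)"
    unfolding power2_eq_square sum_product unfolding sum_distrib_left ..
  also have "\<dots> = (\<Sum>k<n. d k * (e k + (\<Sum>j<k. e j * V j k))\<^sup>2)"
  proof (intro sum.cong refl)
    fix k assume "k \<in> {..<n}"
    then have "(\<Sum>i<n. e i * V i k) = (\<Sum>i<Suc k. e i * V i k)"
      using ldl by (intro sum.mono_neutral_right) (auto simp: ldl_factors_def)
    also have "\<dots> = e k + (\<Sum>j<k. e j * V j k)"
      using ldl \<open>k \<in> {..<n}\<close> by (simp add: ldl_factors_def)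
    finally show "d k * (\<Sum>i<n. e i * V i k)\<^sup>2 = d k * (e k + (\<Sum>j<k. e j * V j k))\<^sup>2"
      by simp
  qed
  finally show ?thesis .
qed

subsection \<open>LDL decompositions of matrices\<close>

abbreviation (input) entries :: "'a mat \<Rightarrow> nat \<Rightarrow> nat \<Rightarrow> 'a" where
  "entries A \<equiv> \<lambda>i j. A $$ (i,j)"

lemma scalar_prod_mult_mat_vec_eq_quad_form:
  fixes H :: "'a::comm_semiring_0 mat"
  assumes "H \<in> carrier_mat n n" "x \<in> carrier_vec n"
  shows "x \<bullet> (H *\<^sub>v x) = quad_form n (entries H) (vec_index x)"
proof -
  have "x \<bullet> (H *\<^sub>v x) = (\<Sum>i<n. x $ i * (\<Sum>j<n. H $$ (i,j) * x $ j))"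
    using assms by (simp add: scalar_prod_def atLeast0LessThan)
  then show ?thesis
    by (simp add: quad_form_def sum_distrib_left mult.assoc)
qed

lemma sym_psd_iff_psd_form:
  assumes "H \<in> carrier_mat n n"
  shows "sym_psd H \<longleftrightarrow> psd_form n (entries H)"
proof -
  have "transpose_mat H = H \<longleftrightarrow> (\<forall>i<n. \<forall>j<n. H $$ (i,j) = H $$ (j,i))"
    using assms by (auto simp: mat_eq_iff)
  moreover have "(\<forall>x\<in>carrier_vec n. 0 \<le> x \<bullet> (H *\<^sub>v x)) \<longleftrightarrow> (\<forall>f. 0 \<le> quad_form n (entries H) f)"
  proof safe
    fix f assume *: "\<forall>x\<in>carrier_vec n. 0 \<le> x \<bullet> (H *\<^sub>v x)"
    have "quad_form n (entries H) (vec_index (Matrix.vec n f)) = quad_form n (entries H) f"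
      by (simp add: quad_form_def)
    then show "0 \<le> quad_form n (entries H) f"
      using * scalar_prod_mult_mat_vec_eq_quad_form[OF assms, of "Matrix.vec n f"]
      by (metis vec_carrier)
  qed (simp add: scalar_prod_mult_mat_vec_eq_quad_form[OF assms])
  ultimately show ?thesis
    using assms by (auto simp: sym_psd_def psd_form_def)
qed

lemma mult_diagonal_mult_transpose_entry:
  fixes A D :: "'a::comm_ring_1 mat"
  assumes A: "A \<in> carrier_mat n n" and D: "D \<in> carrier_mat n n" "diagonal_mat D"
    and ij: "i < n" "j < n"
  shows "(A * D * transpose_mat A) $$ (i,j) = (\<Sum>l<n. A $$ (i,l) * D $$ (l,l) * A $$ (j,l))"
proof -
  have AD: "(A * D) $$ (i,l) = A $$ (i,l) * D $$ (l,l)" if "l < n" for l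
  proof -
    have "(A * D) $$ (i,l) = (\<Sum>k<n. A $$ (i,k) * D $$ (k,l))"
      using A D ij that by (simp add: scalar_prod_def atLeast0LessThan)
    also have "\<dots> = A $$ (i,l) * D $$ (l,l)"
      using D that by (subst sum.remove[of _ l]) (auto simp: diagonal_mat_def)
    finally show ?thesis .
  qed
  have "(A * D * transpose_mat A) $$ (i,j) = (\<Sum>l<n. (A * D) $$ (i,l) * A $$ (j,l))"
    using A D(1) ij by (simp add: scalar_prod_def atLeast0LessThan del: assoc_mult_mat)
  then show ?thesis
    using AD by simp
qed

definition unit_upper :: "'a::one mat \<Rightarrow> nat \<Rightarrow> nat \<Rightarrow> 'a" where
  "unit_upper U i j = (if i = j then 1 else U $$ (i,j))"

lemma ldl_decomp_iff_ldl_factors: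
  assumes H: "H \<in> carrier_mat n n" and U: "U \<in> carrier_mat n n"
    and D: "D \<in> carrier_mat n n" "diagonal_mat D"
    and upper: "\<And>i j. i < n \<Longrightarrow> j \<le> i \<Longrightarrow> U $$ (i,j) = 0"
  shows "ldl_decomp H U D \<longleftrightarrow> ldl_factors n (entries H) (unit_upper U) (\<lambda>k. D $$ (k,k))"
proof -
  let ?A = "U + 1\<^sub>m n"
  have "?A $$ (i,j) = unit_upper U i j" if "i < n" "j < n" for i j
    using U upper that by (simp add: unit_upper_def)
  then have "(?A * D * transpose_mat ?A) $$ (i,j)
      = (\<Sum>l<n. unit_upper U i l * D $$ (l,l) * unit_upper U j l)" if "i < n" "j < n" for i j
    using U D that
    by (subst mult_diagonal_mult_transpose_entry[where n = n]) (auto simp del: index_add_mat)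
  then have "H = ?A * D * transpose_mat ?A \<longleftrightarrow>
      (\<forall>i<n. \<forall>j<n. H $$ (i,j) = (\<Sum>l<n. unit_upper U i l * D $$ (l,l) * unit_upper U j l))"
    using H U D(1) by (auto simp: mat_eq_iff simp del: index_mult_mat(1))
  then show ?thesis
    using assms by (auto simp: ldl_decomp_def Let_def ldl_factors_def unit_upper_def)
qed

lemma sym_psd_ldl_decomp_exists:
  assumes H: "H \<in> carrier_mat n n" "sym_psd H"
  shows "\<exists>U D. ldl_decomp H U D"
proof -
  obtain V d where ldl: "ldl_factors n (entries H) V d"
    using psd_form_imp_ldl_factors H sym_psd_iff_psd_form by blast
  define U where "U = Matrix.mat n n (\<lambda>(i,j). if i < j then V i j else 0)"
  define D where "D = Matrix.mat n n (\<lambda>(i,j). if i = j then d i else 0)"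
  have "ldl_factors n (entries H) (unit_upper U) (\<lambda>k. D $$ (k,k))"
  proof -
    have "unit_upper U i j = V i j" if "i < n" "j < n" for i j
      using ldl that by (auto simp: ldl_factors_def unit_upper_def U_def not_less_iff_gr_or_eq)
    then show ?thesis
      using ldl by (simp add: ldl_factors_def D_def)
  qed
  then have "ldl_decomp H U D"
    using H(1) by (subst ldl_decomp_iff_ldl_factors) (auto simp: U_def D_def diagonal_mat_def)
  then show ?thesis by blast
qed

lemma sym_psd_ldl_U:
  assumes H: "H \<in> carrier_mat n n" "sym_psd H"
  obtains d where "ldl_factors n (entries H) (unit_upper (ldl_U H)) d"
proof -
  have "\<exists>p. case p of (U, D) \<Rightarrow> ldl_decomp H U D"
    using sym_psd_ldl_decomp_exists[OF H] by auto
  from someI_ex[OF this] obtain D where "ldl_decomp H (ldl_U H) D"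
    by (auto simp: ldl_U_def split: prod.splits)
  then have "ldl_factors n (entries H) (unit_upper (ldl_U H)) (\<lambda>k. D $$ (k,k))"
    using H(1) by (subst ldl_decomp_iff_ldl_factors[symmetric]) (auto simp: ldl_decomp_def Let_def)
  then show ?thesis by (rule that)
qed

subsection \<open>Spectrum and trace\<close>

lemma mtrace_mult_commute:
  assumes "A \<in> carrier_mat n n" "B \<in> carrier_mat n n"
  shows "mtrace (A * B) = mtrace (B * A)"
proof -
  have "mtrace (A * B) = (\<Sum>i<n. \<Sum>j<n. A $$ (i,j) * B $$ (j,i))"
    using assms by (auto simp: mtrace_def scalar_prod_def atLeast0LessThan)
  also have "\<dots> = (\<Sum>j<n. \<Sum>i<n. A $$ (i,j) * B $$ (j,i))"
    by (rule sum.swap)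
  also have "\<dots> = mtrace (B * A)"
    using assms by (auto simp: mtrace_def scalar_prod_def atLeast0LessThan mult.commute)
  finally show ?thesis .
qed

lemma mtrace_similar_mat_wit:
  assumes A: "A \<in> carrier_mat n n" and sim: "similar_mat_wit A B P Q"
  shows "mtrace A = mtrace B"
proof -
  note PQ = similar_mat_witD2[OF A sim]
  have "mtrace A = mtrace (P * (B * Q))"
    using PQ by (metis assoc_mult_mat)
  also have "\<dots> = mtrace (B * Q * P)"
    using PQ by (intro mtrace_mult_commute) auto
  also have "B * Q * P = B"
    using PQ by (metis assoc_mult_mat right_mult_one_mat)
  finally show ?thesis .
qed

lemma proots_prod_linear_factors:
  fixes es :: "'a::idom list"
  shows "proots (\<Prod>e\<leftarrow>es. [:- e, 1:]) = mset es"
proof (induction es)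
  case (Cons e es)
  have "(\<Prod>e\<leftarrow>es. [:- e, 1:]) \<noteq> 0"
    by auto
  then have "proots ([:- e, 1:] * (\<Prod>e\<leftarrow>es. [:- e, 1:])) = {#e#} + proots (\<Prod>e\<leftarrow>es. [:- e, 1:])"
    by (subst proots_mult) simp_all
  then show ?case
    using Cons by simp
qed simp

lemma mtrace_eq_sum_proots:
  assumes A: "A \<in> carrier_mat n n" and cp: "char_poly A = (\<Prod>e\<leftarrow>es. [:- e, 1:])"
  shows "mtrace A = sum_mset (proots (char_poly A))"
proof -
  obtain B P Q where BPQ: "schur_decomposition A es = (B, P, Q)"
    by (cases "schur_decomposition A es") auto
  from schur_decomposition[OF A cp BPQ]
  have sim: "similar_mat_wit A B P Q" and diag: "diag_mat B = es" by auto
  have "mtrace A = mtrace B"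
    by (rule mtrace_similar_mat_wit[OF A sim])
  also have "\<dots> = sum_list (diag_mat B)"
    by (simp add: mtrace_def diag_mat_def sum_list_sum_nth atLeast0LessThan)
  finally show ?thesis
    by (simp add: diag cp proots_prod_linear_factors sum_mset_sum_list)
qed

lemma hermitian_form_eq_quad_form_Re_Im:
  fixes h :: "nat \<Rightarrow> nat \<Rightarrow> real" and v :: "nat \<Rightarrow> complex"
  assumes sym: "\<And>i j. i < n \<Longrightarrow> j < n \<Longrightarrow> h i j = h j i"
  shows "(\<Sum>i<n. cnj (v i) * (\<Sum>j<n. of_real (h i j) * v j)) =
    of_real (quad_form n h (\<lambda>i. Re (v i)) + quad_form n h (\<lambda>i. Im (v i)))"
proof (rule complex_eqI)
  have "(\<Sum>i<n. \<Sum>j<n. Re (v i) * h i j * Im (v j)) = (\<Sum>j<n. \<Sum>i<n. Re (v i) * h i j * Im (v j))"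
    by (rule sum.swap)
  also have "\<dots> = (\<Sum>i<n. \<Sum>j<n. Im (v i) * h i j * Re (v j))"
    using sym by (auto intro!: sum.cong simp: mult_ac)
  finally show "Im (\<Sum>i<n. cnj (v i) * (\<Sum>j<n. of_real (h i j) * v j)) =
      Im (of_real (quad_form n h (\<lambda>i. Re (v i)) + quad_form n h (\<lambda>i. Im (v i))))"
    by (simp add: sum_subtractf sum_distrib_left mult.assoc)
qed (simp add: quad_form_def sum.distrib sum_distrib_left mult.assoc)

lemma sum_cmod_square_pos:
  fixes v :: "complex Matrix.vec"
  assumes "v \<in> carrier_vec n" "v \<noteq> 0\<^sub>v n"
  shows "0 < (\<Sum>i<n. (cmod (v $ i))\<^sup>2)"
proof -
  obtain i where "i < n" "v $ i \<noteq> 0"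
    using assms by (metis carrier_vecD eq_vecI index_zero_vec)
  then have "0 < (cmod (v $ i))\<^sup>2" by simp
  also have "\<dots> \<le> (\<Sum>i<n. (cmod (v $ i))\<^sup>2)"
    using \<open>i < n\<close> by (intro member_le_sum) auto
  finally show ?thesis .
qed

lemma sym_psd_complex_eigenvalue:
  assumes H: "H \<in> carrier_mat n n" "sym_psd H" and "eigenvalue (map_mat complex_of_real H) a"
  shows "\<exists>r\<ge>0. a = complex_of_real r"
proof -
  let ?H = "map_mat complex_of_real H" and ?q = "quad_form n (entries H)"
  obtain v where v: "v \<in> carrier_vec n" "v \<noteq> 0\<^sub>v n" "?H *\<^sub>v v = a \<cdot>\<^sub>v v"
    using assms by (auto simp: eigenvalue_def eigenvector_def)
  have psd: "psd_form n (entries H)"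
    using H sym_psd_iff_psd_form by blast
  define Q where "Q = ?q (\<lambda>i. Re (v $ i)) + ?q (\<lambda>i. Im (v $ i))"
  define N where "N = (\<Sum>i<n. (cmod (v $ i))\<^sup>2)"
  have "(\<Sum>j<n. of_real (H $$ (i,j)) * v $ j) = a * v $ i" if "i < n" for i
  proof -
    have "(?H *\<^sub>v v) $ i = (\<Sum>j<n. of_real (H $$ (i,j)) * v $ j)"
      using H(1) v(1) that by (simp add: scalar_prod_def atLeast0LessThan)
    then show ?thesis
      using v that by simp
  qed
  then have "(\<Sum>i<n. cnj (v $ i) * (\<Sum>j<n. of_real (H $$ (i,j)) * v $ j)) = a * of_real N"
    unfolding N_def of_real_sum complex_norm_square by (simp add: sum_distrib_left mult_ac)
  moreover have "(\<Sum>i<n. cnj (v $ i) * (\<Sum>j<n. of_real (H $$ (i,j)) * v $ j)) = of_real Q"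
    unfolding Q_def by (rule hermitian_form_eq_quad_form_Re_Im) (use psd in \<open>simp add: psd_form_def\<close>)
  ultimately have aN: "a * of_real N = of_real Q" by simp
  have "0 \<le> Q"
    using psd by (simp add: Q_def psd_form_def)
  have "0 < N"
    unfolding N_def by (rule sum_cmod_square_pos[OF v(1,2)])
  then have "a = complex_of_real (Q / N)"
    using aN by (simp add: field_simps)
  then show ?thesis
    using \<open>0 < N\<close> \<open>0 \<le> Q\<close> by (intro exI[of _ "Q / N"]) simp
qed

lemma sym_psd_char_poly_factorized:
  assumes H: "H \<in> carrier_mat n n" "sym_psd H"
  obtains es where "char_poly H = (\<Prod>e\<leftarrow>es. [:- e, 1:])" "length es = n" "\<forall>e\<in>set es. 0 \<le> e"
proof -
  let ?H = "map_mat complex_of_real H"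
  have H': "?H \<in> carrier_mat n n" using H by simp
  obtain as where as: "char_poly ?H = (\<Prod>a\<leftarrow>as. [:- a, 1:])" "length as = n"
    using char_poly_factorized[OF H'] by blast
  have "\<exists>r\<ge>0. a = complex_of_real r" if "a \<in> set as" for a
  proof -
    have "poly (char_poly ?H) a = 0"
      unfolding as(1) using that by (rule linear_poly_root)
    then show ?thesis
      using eigenvalue_root_char_poly[OF H'] sym_psd_complex_eigenvalue[OF H] by blast
  qed
  then obtain r where r: "\<And>a. a \<in> set as \<Longrightarrow> 0 \<le> r a \<and> a = complex_of_real (r a)"
    by metis
  define es where "es = map r as"
  have as_es: "as = map complex_of_real es"
    using r by (simp add: es_def map_idI[symmetric] o_def)
  interpret poly_of_real: map_poly_inj_idom_hom complex_of_real ..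
  have "map_poly complex_of_real (char_poly H) = char_poly ?H"
    by (simp add: of_real_hom.char_poly_hom[OF H(1)])
  also have "\<dots> = map_poly complex_of_real (\<Prod>e\<leftarrow>es. [:- e, 1:])"
    unfolding as(1) as_es
    by (simp add: poly_of_real.hom_prod_list o_def del: poly_of_real.prod_list_map_hom)
  finally have "char_poly H = (\<Prod>e\<leftarrow>es. [:- e, 1:])"
    by simp
  moreover have "length es = n" "\<forall>e\<in>set es. 0 \<le> e"
    using as(2) r by (auto simp: es_def)
  ultimately show ?thesis by (rule that)
qed

lemma same_spectrum_psdD:
  assumes "H \<in> carrier_mat n n" "Ht \<in> same_spectrum_psd H"
  shows "Ht \<in> carrier_mat n n" "sym_psd Ht"
  using assms by (auto simp: same_spectrum_psd_def sym_psd_def)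

lemma same_spectrum_psd_mtrace_eq:
  assumes H: "H \<in> carrier_mat n n" "sym_psd H" and Ht: "Ht \<in> same_spectrum_psd H"
  shows "mtrace Ht = mtrace H"
proof -
  note Ht' = same_spectrum_psdD[OF H(1) Ht]
  have mtrace: "mtrace A = sum_mset (proots (char_poly A))" "char_poly A \<noteq> 0"
    if "A \<in> carrier_mat n n" "sym_psd A" for A
  proof -
    obtain es where "char_poly A = (\<Prod>e\<leftarrow>es. [:- e, 1:])"
      using sym_psd_char_poly_factorized[OF \<open>A \<in> carrier_mat n n\<close> \<open>sym_psd A\<close>] by blast
    then show "mtrace A = sum_mset (proots (char_poly A))"
      by (rule mtrace_eq_sum_proots[OF \<open>A \<in> carrier_mat n n\<close>])
    show "char_poly A \<noteq> 0"
      using degree_monic_char_poly[OF \<open>A \<in> carrier_mat n n\<close>] by auto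
  qed
  have "proots (char_poly Ht) = proots (char_poly H)"
    using Ht mtrace(2)[OF H] mtrace(2)[OF Ht']
    by (intro multiset_eqI) (simp add: same_spectrum_psd_def eig_mult_def)
  then show ?thesis
    using mtrace(1)[OF H] mtrace(1)[OF Ht'] by simp
qed

lemma psd_form_diagonal:
  assumes "\<And>i. i < n \<Longrightarrow> 0 \<le> d i"
  shows "psd_form n (\<lambda>i j. if i = j then d i else 0)"
proof -
  have "quad_form n (\<lambda>i j. if i = j then d i else 0) f = (\<Sum>i<n. d i * (f i)\<^sup>2)" for f
    by (simp add: quad_form_def if_distrib if_distribR power2_eq_square mult_ac cong: if_cong)
  then show ?thesis
    using assms by (auto simp: psd_form_def intro!: sum_nonneg)
qed

lemma diagonal_mat_in_same_spectrum_psd: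
  assumes H: "H \<in> carrier_mat n n" "sym_psd H"
  obtains L where "L \<in> same_spectrum_psd H" "diagonal_mat L"
proof -
  obtain es where es: "char_poly H = (\<Prod>e\<leftarrow>es. [:- e, 1:])" "length es = n" "\<forall>e\<in>set es. 0 \<le> e"
    using sym_psd_char_poly_factorized[OF H] by blast
  define L where "L = Matrix.mat n n (\<lambda>(i,j). if i = j then es ! i else 0)"
  have L: "L \<in> carrier_mat n n" "diagonal_mat L" "upper_triangular L"
    by (auto simp: L_def diagonal_mat_def upper_triangular_def)
  have "diag_mat L = es"
    using es(2) by (auto simp: diag_mat_def L_def intro: nth_equalityI)
  then have "char_poly L = char_poly H"
    using char_poly_upper_triangular[OF L(1,3)] es(1) by simp
  moreover have "sym_psd L"
    unfolding sym_psd_iff_psd_form[OF L(1)]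
  proof -
    have "psd_form n (\<lambda>i j. if i = j then es ! i else 0)"
      using es(2,3) by (intro psd_form_diagonal) simp
    then show "psd_form n (entries L)"
      by (simp add: psd_form_def quad_form_def L_def)
  qed
  ultimately have "L \<in> same_spectrum_psd H"
    using H(1) L(1) by (simp add: same_spectrum_psd_def eig_mult_def)
  then show ?thesis using that L(2) by blast
qed

lemma SUP_same_spectrum_psd:
  fixes F :: "real mat \<Rightarrow> ereal"
  assumes H: "H \<in> carrier_mat n n" "sym_psd H"
    and le: "\<And>Ht. Ht \<in> carrier_mat n n \<Longrightarrow> sym_psd Ht \<Longrightarrow> F Ht \<le> ereal (c * mtrace Ht)"
    and diagonal: "\<And>L. L \<in> carrier_mat n n \<Longrightarrow> sym_psd L \<Longrightarrow> diagonal_mat L \<Longrightarrow> F L = ereal (c * mtrace L)"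
  shows "(SUP Ht\<in>same_spectrum_psd H. F Ht) = ereal (c * mtrace H)"
proof (rule antisym)
  show "(SUP Ht\<in>same_spectrum_psd H. F Ht) \<le> ereal (c * mtrace H)"
    using le same_spectrum_psdD[OF H(1)] same_spectrum_psd_mtrace_eq[OF H]
    by (intro SUP_least) metis
  obtain L where L: "L \<in> same_spectrum_psd H" "diagonal_mat L"
    using diagonal_mat_in_same_spectrum_psd[OF H] .
  then have "F L = ereal (c * mtrace H)"
    using diagonal same_spectrum_psdD[OF H(1)] same_spectrum_psd_mtrace_eq[OF H] by metis
  then show "ereal (c * mtrace H) \<le> (SUP Ht\<in>same_spectrum_psd H. F Ht)"
    using L(1) by (metis SUP_upper)
qed

subsection \<open>Feedback and rounding errors\<close>

definition rounding_error :: "(real \<Rightarrow> real \<Rightarrow> real) \<Rightarrow> real \<Rightarrow> real \<Rightarrow> real" where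
  "rounding_error Q v z = Q v z - z"

definition ldlq_entry :: "(nat \<Rightarrow> real \<Rightarrow> real) \<Rightarrow> (nat \<Rightarrow> real) \<Rightarrow> real mat \<Rightarrow> nat \<Rightarrow> real" where
  "ldlq_entry Q w U k = ldlq_row Q w U (Suc k) ! k"

definition ldlq_feedback :: "(nat \<Rightarrow> real \<Rightarrow> real) \<Rightarrow> (nat \<Rightarrow> real) \<Rightarrow> real mat \<Rightarrow> nat \<Rightarrow> real" where
  "ldlq_feedback Q w U k = (\<Sum>j<k. (w j - ldlq_entry Q w U j) * U $$ (j,k))"

lemma length_ldlq_row [simp]: "length (ldlq_row Q w U k) = k"
  by (induction k) (simp_all add: Let_def)

lemma nth_ldlq_row: "k < n \<Longrightarrow> ldlq_row Q w U n ! k = ldlq_entry Q w U k"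
proof (induction n)
  case (Suc n)
  then show ?case
    by (cases "k = n") (simp_all add: ldlq_entry_def Let_def nth_append)
qed simp

lemma ldlq_entry_eq: "ldlq_entry Q w U k = Q k (w k + ldlq_feedback Q w U k)"
proof -
  have "ldlq_entry Q w U k = Q k (w k + (\<Sum>j<k. (w j - ldlq_row Q w U k ! j) * U $$ (j,k)))"
    unfolding ldlq_entry_def by (simp add: Let_def nth_append)
  then show ?thesis
    by (simp add: ldlq_feedback_def nth_ldlq_row)
qed

lemma ldlq_feedback_cong:
  assumes "\<And>j. j < k \<Longrightarrow> w j = w' j" "\<And>j. j < k \<Longrightarrow> Q j = Q' j"
  shows "ldlq_feedback Q w U k = ldlq_feedback Q' w' U k"
  using assms
proof (induction k rule: less_induct)
  case (less k)
  have "ldlq_entry Q w U j = ldlq_entry Q' w' U j" if "j < k" for j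
    using less.IH[OF that] less.prems that by (simp add: ldlq_entry_eq)
  then show ?case
    using less.prems by (simp add: ldlq_feedback_def)
qed

lemma borel_measurable_ldlq_feedback:
  assumes Q [measurable]: "(\<lambda>(u,z). Q u z) \<in> borel_measurable (borel \<Otimes>\<^sub>M borel)"
    and u: "\<And>j. j < k \<Longrightarrow> u j \<in> borel_measurable M"
    and w: "\<And>j. j < k \<Longrightarrow> w j \<in> borel_measurable M"
  shows "(\<lambda>x. ldlq_feedback (\<lambda>j. Q (u j x)) (\<lambda>j. w j x) U k) \<in> borel_measurable M"
  using u w
proof (induction k rule: less_induct)
  case (less k)
  have "(\<lambda>x. ldlq_entry (\<lambda>j. Q (u j x)) (\<lambda>j. w j x) U j) \<in> borel_measurable M" if "j < k" for j
  proof -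
    have [measurable]: "(\<lambda>x. ldlq_feedback (\<lambda>j. Q (u j x)) (\<lambda>j. w j x) U j) \<in> borel_measurable M"
      using less that by auto
    have [measurable]: "u j \<in> borel_measurable M" "w j \<in> borel_measurable M"
      using less.prems that by auto
    show ?thesis
      unfolding ldlq_entry_eq by measurable
  qed
  then show ?case
    unfolding ldlq_feedback_def using less.prems
    by (intro borel_measurable_sum borel_measurable_times borel_measurable_diff) auto
qed

definition LDLQ_feedback ::
  "(real \<Rightarrow> real \<Rightarrow> real) \<Rightarrow> real mat \<Rightarrow> (nat \<times> nat \<Rightarrow> real) \<Rightarrow> (nat \<times> nat \<Rightarrow> real) \<Rightarrow> nat \<Rightarrow> nat \<Rightarrow> real" where
  "LDLQ_feedback Q U w u i k = ldlq_feedback (\<lambda>j. Q (u (i,j))) (\<lambda>j. w (i,j)) U k"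

lemma LDLQ_feedback_cong:
  assumes "\<And>j. j < k \<Longrightarrow> w (i,j) = w' (i,j)" "\<And>j. j < k \<Longrightarrow> u (i,j) = u' (i,j)"
  shows "LDLQ_feedback Q U w u i k = LDLQ_feedback Q U w' u' i k"
  unfolding LDLQ_feedback_def by (rule ldlq_feedback_cong) (simp_all add: assms)

lemma index_LDLQ:
  assumes "W \<in> carrier_mat m n" "i < m" "k < n"
  shows "LDLQ Q W H u $$ (i,k) = Q (u (i,k)) (W $$ (i,k) + LDLQ_feedback Q (ldl_U H) (($$) W) u i k)"
  using assms by (simp add: LDLQ_def Let_def nth_ldlq_row ldlq_entry_eq LDLQ_feedback_def)

lemma LDLQ_feedback_eq_sum:
  assumes "W \<in> carrier_mat m n" "i < m" "k < n"
  shows "LDLQ_feedback Q (ldl_U H) (($$) W) u i k =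
    (\<Sum>j<k. (W $$ (i,j) - LDLQ Q W H u $$ (i,j)) * ldl_U H $$ (j,k))"
  using assms
  by (auto simp: LDLQ_def Let_def nth_ldlq_row LDLQ_feedback_def ldlq_feedback_def intro!: sum.cong)

subsection \<open>The proxy loss\<close>

lemma sum_diag_eq_mtrace:
  assumes "H \<in> carrier_mat n n"
  shows "(\<Sum>i<m. \<Sum>k<n. H $$ (k,k) * c) = real m * c * mtrace H"
  using assms by (simp add: mtrace_def sum_distrib_left mult_ac)

lemma proxy_eq_sum_quad_form:
  assumes "X \<in> carrier_mat m n" "W \<in> carrier_mat m n" "H \<in> carrier_mat n n"
  shows "proxy X W H = (\<Sum>i<m. quad_form n (entries H) (\<lambda>k. X $$ (i,k) - W $$ (i,k)))"
proof -
  let ?E = "X - W"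
  have "proxy X W H = (\<Sum>i<m. \<Sum>l<n. (\<Sum>k<n. ?E $$ (i,k) * H $$ (k,l)) * ?E $$ (i,l))"
    using assms by (auto simp: proxy_def mtrace_def scalar_prod_def atLeast0LessThan intro!: sum.cong)
  also have "\<dots> = (\<Sum>i<m. \<Sum>k<n. \<Sum>l<n. ?E $$ (i,k) * H $$ (k,l) * ?E $$ (i,l))"
    unfolding sum_distrib_right by (intro sum.cong refl sum.swap)
  also have "\<dots> = (\<Sum>i<m. quad_form n (entries H) (\<lambda>k. X $$ (i,k) - W $$ (i,k)))"
    unfolding quad_form_def using assms by (intro sum.cong refl) auto
  finally show ?thesis .
qed

lemma proxy_entrywise:
  assumes "W \<in> carrier_mat m n" "H \<in> carrier_mat n n"
  shows "proxy (entrywise Q W H u) W H =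
    (\<Sum>i<m. quad_form n (entries H) (\<lambda>k. rounding_error Q (u (i,k)) (W $$ (i,k))))"
proof -
  have "entrywise Q W H u \<in> carrier_mat m n"
    using assms by (simp add: entrywise_def)
  from proxy_eq_sum_quad_form[OF this assms] show ?thesis
    using assms by (simp add: quad_form_def entrywise_def rounding_error_def)
qed

text \<open>With \<open>E = What - W\<close>, the errors of the single rounding steps are the entries of \<open>E (U + I)\<close>,
  so the unit factors of \<open>H\<close> are absorbed and only the pivots remain.\<close>

lemma proxy_LDLQ:
  assumes ldl: "ldl_factors n (entries H) (unit_upper (ldl_U H)) d"
    and H: "H \<in> carrier_mat n n" and W: "W \<in> carrier_mat m n"
  shows "proxy (LDLQ Q W H u) W H = (\<Sum>i<m. \<Sum>k<n.
    d k * (rounding_error Q (u (i,k)) (W $$ (i,k) + LDLQ_feedback Q (ldl_U H) (($$) W) u i k))\<^sup>2)"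
proof -
  let ?X = "LDLQ Q W H u" and ?fb = "LDLQ_feedback Q (ldl_U H) (($$) W) u"
  have X: "?X \<in> carrier_mat m n"
    using W by (simp add: LDLQ_def Let_def)
  have step_error: "?X $$ (i,k) - W $$ (i,k)
        + (\<Sum>j<k. (?X $$ (i,j) - W $$ (i,j)) * unit_upper (ldl_U H) j k)
      = rounding_error Q (u (i,k)) (W $$ (i,k) + ?fb i k)" if "i < m" "k < n" for i k
  proof -
    have "(\<Sum>j<k. (?X $$ (i,j) - W $$ (i,j)) * unit_upper (ldl_U H) j k) = - ?fb i k"
      unfolding LDLQ_feedback_eq_sum[OF W that] sum_negf[symmetric]
      by (intro sum.cong refl) (simp add: unit_upper_def algebra_simps)
    then show ?thesis
      by (simp add: index_LDLQ[OF W that] rounding_error_def)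
  qed
  show ?thesis
    unfolding proxy_eq_sum_quad_form[OF X W H] ldl_factors_quad_form[OF ldl]
    by (intro sum.cong refl) (simp add: step_error)
qed

definition expected_proxy :: "algo \<Rightarrow> nat \<Rightarrow> real mat \<Rightarrow> real mat \<Rightarrow> real" where
  "expected_proxy A m H W = (\<integral>u. proxy (A W H u) W H \<partial>unif_cube m (dim_row H))"

lemma L_worst_le:
  assumes "H \<in> carrier_mat n n" "\<And>W. W \<in> carrier_mat m n \<Longrightarrow> expected_proxy A m H W \<le> c"
  shows "L_worst A m H \<le> ereal c"
  unfolding L_worst_def using assms by (intro SUP_least) (simp add: expected_proxy_def)

lemma L_worst_ge:
  assumes "H \<in> carrier_mat n n" "W \<in> carrier_mat m n"
  shows "ereal (expected_proxy A m H W) \<le> L_worst A m H"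
  unfolding L_worst_def expected_proxy_def using assms by (intro SUP_upper) simp

lemma L_avg_eq_integral_expected_proxy:
  assumes "H \<in> carrier_mat n n"
  shows "L_avg A m H = (\<integral>w. expected_proxy A m H (Matrix.mat m n w) \<partial>unif_cube m n)"
  using assms by (simp add: L_avg_def expected_proxy_def Let_def)

subsection \<open>Resampling one coordinate of a product\<close>

lemma integral_double_sum_mult_right:
  fixes f :: "'i \<Rightarrow> 'j \<Rightarrow> 'a \<Rightarrow> real"
  assumes "\<And>i k. i \<in> I \<Longrightarrow> k \<in> K \<Longrightarrow> integrable M (f i k)"
  shows "(\<integral>x. (\<Sum>i\<in>I. \<Sum>k\<in>K. c i k * f i k x) \<partial>M) = (\<Sum>i\<in>I. \<Sum>k\<in>K. c i k * (\<integral>x. f i k x \<partial>M))"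
  using assms by simp

context product_prob_space
begin

lemma integral_PiM_resample:
  fixes F :: "('i \<Rightarrow> 'a) \<Rightarrow> 'b::{banach, second_countable_topology}"
  assumes p: "p \<in> I" and F: "integrable (PiM I M) F"
  shows "(\<integral>x. (\<integral>y. F (x(p := y)) \<partial>M p) \<partial>PiM I M) = (\<integral>x. F x \<partial>PiM I M)"
proof -
  interpret resample: pair_prob_space "M p" "PiM I M" ..
  let ?upd = "\<lambda>(y, x). x(p := y)"
  have "insert p I = I" using p by auto
  with distr_pair_PiM_eq_PiM[of I M p]
  have distr: "distr (M p \<Otimes>\<^sub>M PiM I M) (PiM I M) ?upd = PiM I M"
    using prob_space by simp
  have upd: "?upd \<in> measurable (M p \<Otimes>\<^sub>M PiM I M) (PiM I M)"
    unfolding case_prod_unfold using p by (intro measurable_fun_upd[where J = I]) auto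
  have F_upd: "integrable (M p \<Otimes>\<^sub>M PiM I M) (\<lambda>(y, x). F (x(p := y)))"
    using integrable_distr[OF upd, of F] F unfolding distr by (simp add: case_prod_unfold)
  have "(\<integral>x. F x \<partial>PiM I M) = (\<integral>x. F x \<partial>distr (M p \<Otimes>\<^sub>M PiM I M) (PiM I M) ?upd)"
    by (simp only: distr)
  also have "\<dots> = (\<integral>(y, x). F (x(p := y)) \<partial>(M p \<Otimes>\<^sub>M PiM I M))"
    using F upd by (subst integral_distr) (auto simp: case_prod_unfold)
  finally show ?thesis
    using resample.integral_snd[OF F_upd] by simp
qed

lemma integral_PiM_component:
  fixes f :: "'a \<Rightarrow> 'b::{banach, second_countable_topology}"
  assumes "p \<in> I" "f \<in> borel_measurable (M p)"
  shows "(\<integral>x. f (x p) \<partial>PiM I M) = (\<integral>y. f y \<partial>M p)"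
proof -
  have "(\<integral>x. f (x p) \<partial>PiM I M) = (\<integral>y. f y \<partial>distr (PiM I M) (M p) (\<lambda>x. x p))"
    using assms by (subst integral_distr) auto
  then show ?thesis
    using assms(1) by (simp add: PiM_component)
qed

lemma
  fixes f :: "'a \<Rightarrow> real"
  assumes p: "\<And>k. k \<in> K \<Longrightarrow> p k \<in> I" and f: "\<And>k. k \<in> K \<Longrightarrow> f \<in> borel_measurable (M (p k))"
    and bounded: "\<And>y. \<bar>f y\<bar> \<le> B"
  shows integrable_PiM_weighted_sum: "integrable (PiM I M) (\<lambda>x. \<Sum>k\<in>K. c k * f (x (p k)))"
    and integral_PiM_weighted_sum: "(\<integral>x. (\<Sum>k\<in>K. c k * f (x (p k))) \<partial>PiM I M) =
      (\<Sum>k\<in>K. c k * (\<integral>y. f y \<partial>M (p k)))"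
proof -
  have int: "integrable (PiM I M) (\<lambda>x. f (x (p k)))" if "k \<in> K" for k
  proof (rule P.integrable_const_bound[where B = B])
    show "(\<lambda>x. f (x (p k))) \<in> borel_measurable (PiM I M)"
      using p[OF that] f[OF that] by measurable
  qed (use bounded in simp)
  then show "integrable (PiM I M) (\<lambda>x. \<Sum>k\<in>K. c k * f (x (p k)))"
    by (intro Bochner_Integration.integrable_sum integrable_mult_right)
  show "(\<integral>x. (\<Sum>k\<in>K. c k * f (x (p k))) \<partial>PiM I M) = (\<Sum>k\<in>K. c k * (\<integral>y. f y \<partial>M (p k)))"
    using int by (simp add: integral_PiM_component[OF p f])
qed

lemma
  fixes f g :: "'a \<Rightarrow> real"
  assumes pq: "p \<in> I" "q \<in> I"
    and meas: "f \<in> borel_measurable (M p)" "g \<in> borel_measurable (M q)"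
    and bounded: "\<And>y. \<bar>f y\<bar> \<le> A" "\<And>y. \<bar>g y\<bar> \<le> B"
  shows integrable_PiM_mult_components: "integrable (PiM I M) (\<lambda>x. f (x p) * g (x q))"
    and integral_PiM_mult_components:
      "p \<noteq> q \<Longrightarrow> (\<integral>x. f (x p) * g (x q) \<partial>PiM I M) = (\<integral>y. f y \<partial>M p) * (\<integral>y. g y \<partial>M q)"
proof -
  show int: "integrable (PiM I M) (\<lambda>x. f (x p) * g (x q))"
  proof (rule P.integrable_const_bound)
    show "AE x in PiM I M. norm (f (x p) * g (x q)) \<le> A * B"
      using bounded by (auto simp: abs_mult intro!: mult_mono order_trans[OF abs_ge_zero bounded(1)])
    show "(\<lambda>x. f (x p) * g (x q)) \<in> borel_measurable (PiM I M)"
      using pq meas by measurable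
  qed
  assume "p \<noteq> q"
  have "(\<integral>x. f (x p) * g (x q) \<partial>PiM I M) = (\<integral>x. (\<integral>y. f y * g (x q) \<partial>M p) \<partial>PiM I M)"
    using integral_PiM_resample[OF pq(1) int] \<open>p \<noteq> q\<close> by simp
  also have "\<dots> = (\<integral>y. f y \<partial>M p) * (\<integral>y. g y \<partial>M q)"
    by (simp add: integral_PiM_component[OF pq(2) meas(2)])
  finally show "(\<integral>x. f (x p) * g (x q) \<partial>PiM I M) = (\<integral>y. f y \<partial>M p) * (\<integral>y. g y \<partial>M q)" .
qed

text \<open>Independence removes the covariances, so only the means meet the off-diagonal entries.\<close>

lemma
  fixes e :: "nat \<Rightarrow> 'a \<Rightarrow> real" and h :: "nat \<Rightarrow> nat \<Rightarrow> real"
  assumes inj: "inj_on p {..<n}" and p: "\<And>k. k < n \<Longrightarrow> p k \<in> I"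
    and meas: "\<And>k. k < n \<Longrightarrow> e k \<in> borel_measurable (M (p k))"
    and bounded: "\<And>k y. k < n \<Longrightarrow> \<bar>e k y\<bar> \<le> B"
  shows integrable_PiM_quad_form: "integrable (PiM I M) (\<lambda>x. quad_form n h (\<lambda>k. e k (x (p k))))"
    and integral_PiM_quad_form: "(\<integral>x. quad_form n h (\<lambda>k. e k (x (p k))) \<partial>PiM I M) =
      quad_form n h (\<lambda>k. \<integral>y. e k y \<partial>M (p k)) +
      (\<Sum>k<n. h k k * ((\<integral>y. (e k y)\<^sup>2 \<partial>M (p k)) - (\<integral>y. e k y \<partial>M (p k))\<^sup>2))"
proof -
  let ?E = "\<lambda>k. \<integral>y. e k y \<partial>M (p k)" and ?E2 = "\<lambda>k. \<integral>y. (e k y)\<^sup>2 \<partial>M (p k)"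
  have int: "integrable (PiM I M) (\<lambda>x. e k (x (p k)) * e l (x (p l)))" if "k < n" "l < n" for k l
    using that by (intro integrable_PiM_mult_components[where A = B and B = B] p meas bounded)
  have val: "(\<integral>x. e k (x (p k)) * e l (x (p l)) \<partial>PiM I M) = (if l = k then ?E2 k else ?E k * ?E l)"
    if kl: "k < n" "l < n" for k l
  proof (cases "l = k")
    case True
    then show ?thesis
      using integral_PiM_component[of "p k" "\<lambda>y. (e k y)\<^sup>2"] p[OF kl(1)] meas[OF kl(1)]
      by (simp add: power2_eq_square)
  next
    case False
    then have "p k \<noteq> p l"
      using inj kl by (auto dest: inj_onD)
    then show ?thesis
      using False kl p meas bounded
      by (subst integral_PiM_mult_components[where A = B and B = B]) auto
  qed
  have quad: "quad_form n h (\<lambda>k. e k (x (p k)))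
      = (\<Sum>k<n. \<Sum>l<n. h k l * (e k (x (p k)) * e l (x (p l))))" for x
    by (simp add: quad_form_def mult_ac)
  show "integrable (PiM I M) (\<lambda>x. quad_form n h (\<lambda>k. e k (x (p k))))"
    unfolding quad by (intro Bochner_Integration.integrable_sum integrable_mult_right int) auto
  have "(\<integral>x. quad_form n h (\<lambda>k. e k (x (p k))) \<partial>PiM I M)
      = (\<Sum>k<n. \<Sum>l<n. h k l * (\<integral>x. e k (x (p k)) * e l (x (p l)) \<partial>PiM I M))"
    unfolding quad by (rule integral_double_sum_mult_right) (use int in simp)
  also have "\<dots> = (\<Sum>k<n. \<Sum>l<n. ?E k * h k l * ?E l + (if l = k then h k k * (?E2 k - (?E k)\<^sup>2) else 0))"
    by (intro sum.cong refl) (auto simp: val power2_eq_square algebra_simps)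
  also have "\<dots> = quad_form n h ?E + (\<Sum>k<n. h k k * (?E2 k - (?E k)\<^sup>2))"
    by (simp add: quad_form_def sum.distrib)
  finally show "(\<integral>x. quad_form n h (\<lambda>k. e k (x (p k))) \<partial>PiM I M) =
      quad_form n h ?E + (\<Sum>k<n. h k k * (?E2 k - (?E k)\<^sup>2))" .
qed

end

subsection \<open>Periodic integrands\<close>

lemma interval_integral_shift:
  fixes f :: "real \<Rightarrow> 'a::{banach, second_countable_topology}" and a b t :: real
  shows "(LBINT x=a+t..b+t. f x) = (LBINT x=a..b. f (x + t))"
proof -
  have "(LBINT x:{p+t<..<q+t}. f x) = (LBINT x:{p<..<q}. f (x + t))" for p q
  proof -
    have "(LBINT x:{p+t<..<q+t}. f x)
        = (\<integral>x. indicator {p+t<..<q+t} (t + 1 * x) *\<^sub>R f (t + 1 * x) \<partial>lborel)"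
      unfolding set_lebesgue_integral_def by (subst lborel_integral_real_affine[of 1 _ t]) simp_all
    also have "\<dots> = (LBINT x:{p<..<q}. f (x + t))"
      unfolding set_lebesgue_integral_def
      by (intro Bochner_Integration.integral_cong refl) (auto simp: indicator_def add.commute)
    finally show ?thesis .
  qed
  then show ?thesis
    by (simp add: interval_lebesgue_integral_def)
qed

lemma interval_integrable_bounded:
  fixes h :: "real \<Rightarrow> 'a::{banach, second_countable_topology}" and a b :: real
  assumes [measurable]: "h \<in> borel_measurable borel" and bounded: "\<And>x. norm (h x) \<le> B"
  shows "interval_lebesgue_integrable lborel a b h"
proof -
  have "set_integrable lborel {p<..<q} h" for p q :: real
  proof (rule set_integrable_bound)
    show "set_integrable lborel {p<..<q} (\<lambda>_. B)"
      using emeasure_lborel_box_finite[of p q] by (simp add: set_integrable_def)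
    show "AE x in lborel. x \<in> {p<..<q} \<longrightarrow> norm (h x) \<le> norm B"
      using order_trans[OF bounded abs_ge_self] by simp
  qed (simp add: set_borel_measurable_def)
  then show ?thesis
    by (simp add: interval_lebesgue_integrable_def)
qed

lemma interval_integral_period:
  fixes h :: "real \<Rightarrow> 'a::{banach, second_countable_topology}" and c T :: real
  assumes integrable: "\<And>(a::real) (b::real). interval_lebesgue_integrable lborel a b h"
    and periodic: "\<And>x. h (x + T) = h x"
  shows "(LBINT x=c..c+T. h x) = (LBINT x=0..T. h x)"
proof -
  let ?J = "\<lambda>(a::real) (b::real). LBINT x=a..b. h x"
  have split: "?J a b + ?J b d = ?J a d" for a b d
    using integrable[of "min a (min b d)" "max a (max b d)"] by (intro interval_integral_sum) simp
  have "?J T (c + T) = ?J 0 c"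
    using interval_integral_shift[of 0 T c h] by (simp add: periodic)
  then show ?thesis
    using split[of c T "c + T"] split[of 0 c T] by (simp add: zero_ereal_def add.commute)
qed

subsection \<open>The uniform distribution\<close>

lemma sets_unif01 [measurable_cong, simp]: "sets unif01 = sets borel"
  by (simp add: unif01_def)

lemma space_unif01 [simp]: "space unif01 = UNIV"
  by (simp add: unif01_def)

interpretation unif01: prob_space unif01
  unfolding unif01_def by (rule prob_space_uniform_measure) auto

lemma measure_unif01_UNIV [simp]: "measure unif01 UNIV = 1"
  using unif01.prob_space by simp

interpretation unif_cube: product_prob_space "\<lambda>_. unif01" "{0..<m} \<times> {0..<n}"
  rewrites "PiM ({0..<m} \<times> {0..<n}) (\<lambda>_. unif01) = unif_cube m n" for m n :: nat
  by unfold_locales (simp add: unif_cube_def)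

interpretation unif_cube_pair: pair_prob_space "unif_cube m n" "unif_cube m n" for m n ..

lemma borel_measurable_unif_cube_component:
  assumes "i < m" "k < n"
  shows "(\<lambda>x. x (i,k)) \<in> borel_measurable (unif_cube m n)"
proof -
  have "(\<lambda>x. x (i,k)) \<in> measurable (unif_cube m n) unif01"
    unfolding unif_cube_def using assms by (intro measurable_component_singleton) auto
  then show ?thesis by (simp cong: measurable_cong_sets)
qed

lemma integral_unif01:
  fixes f :: "real \<Rightarrow> 'a::{banach, second_countable_topology}"
  assumes [measurable]: "f \<in> borel_measurable borel"
  shows "(\<integral>x. f x \<partial>unif01) = (LBINT x=0..1. f x)"
proof -
  have "unif01 = density lborel (\<lambda>x. ennreal (indicator {0..1} x))"
    unfolding unif01_def uniform_measure_def
    by (intro density_cong) (auto simp: indicator_def divide_ennreal_def)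
  then have "(\<integral>x. f x \<partial>unif01) = (\<integral>x. f x \<partial>density lborel (\<lambda>x. ennreal (indicator {0..1} x)))"
    by (rule arg_cong)
  also have "\<dots> = (LBINT x:{0..1}. f x)"
    unfolding set_lebesgue_integral_def by (rule integral_density) auto
  finally show ?thesis
    using interval_integral_Icc[of 0 1 f] by (simp add: zero_ereal_def one_ereal_def)
qed

lemma integral_unif01_cong:
  fixes f g :: "real \<Rightarrow> 'a::{banach, second_countable_topology}"
  assumes "f \<in> borel_measurable borel" "g \<in> borel_measurable borel"
    and "\<And>x. 0 < x \<Longrightarrow> x < 1 \<Longrightarrow> f x = g x"
  shows "(\<integral>x. f x \<partial>unif01) = (\<integral>x. g x \<partial>unif01)"
  unfolding integral_unif01[OF assms(1)] integral_unif01[OF assms(2)]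
  using assms(3) by (intro interval_integral_cong) (auto simp: einterval_iff min_def max_def)

lemma integral_unif01_periodic:
  fixes h :: "real \<Rightarrow> 'a::{banach, second_countable_topology}" and c :: real
  assumes h: "h \<in> borel_measurable borel" and bounded: "\<And>x. norm (h x) \<le> B"
    and periodic: "\<And>x. h (x + 1) = h x"
  shows "(\<integral>x. h x \<partial>unif01) = (LBINT x=c..c+1. h x)"
  using interval_integral_period[OF interval_integrable_bounded[OF h bounded] periodic, of c]
  by (simp add: integral_unif01[OF h] zero_ereal_def one_ereal_def)

lemma integral_unif01_shift:
  fixes h :: "real \<Rightarrow> 'a::{banach, second_countable_topology}"
  assumes [measurable]: "h \<in> borel_measurable borel" and "\<And>x. norm (h x) \<le> B" "\<And>x. h (x + 1) = h x"
  shows "(\<integral>x. h (x + c) \<partial>unif01) = (\<integral>x. h x \<partial>unif01)"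
  using integral_unif01_periodic[of h B c] interval_integral_shift[of 0 c 1 h] assms(2,3)
  by (simp add: integral_unif01 zero_ereal_def one_ereal_def add.commute)

subsection \<open>Expected losses of a rounding routine\<close>

definition bias :: "(real \<Rightarrow> real \<Rightarrow> real) \<Rightarrow> real \<Rightarrow> real" where
  "bias Q z = (\<integral>v. rounding_error Q v z \<partial>unif01)"

definition mse :: "(real \<Rightarrow> real \<Rightarrow> real) \<Rightarrow> real \<Rightarrow> real" where
  "mse Q z = (\<integral>v. (rounding_error Q v z)\<^sup>2 \<partial>unif01)"

definition avg_mse :: "(real \<Rightarrow> real \<Rightarrow> real) \<Rightarrow> real" where
  "avg_mse Q = (\<integral>z. mse Q z \<partial>unif01)"

locale rounding =
  fixes Q :: "real \<Rightarrow> real \<Rightarrow> real"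
  assumes measurable_Q [measurable]: "(\<lambda>(v,z). Q v z) \<in> borel_measurable (borel \<Otimes>\<^sub>M borel)"
    and Q_add_1: "Q v (z + 1) = Q v z + 1"
    and rounding_error_le_1: "\<bar>rounding_error Q v z\<bar> \<le> 1"
    and mse_le_quarter: "mse Q z \<le> 1/4"
    and mse_half: "mse Q (1/2) = 1/4"
    and integral_bias: "(\<integral>z. bias Q z \<partial>unif01) = 0"
begin

lemma measurable_rounding_error [measurable]:
  "(\<lambda>(v,z). rounding_error Q v z) \<in> borel_measurable (borel \<Otimes>\<^sub>M borel)"
  unfolding rounding_error_def by measurable

lemma measurable_bias [measurable]: "bias Q \<in> borel_measurable borel"
  unfolding bias_def by measurable

lemma measurable_mse [measurable]: "mse Q \<in> borel_measurable borel"
  unfolding mse_def by measurable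

lemma rounding_error_squared_le_1: "(rounding_error Q v z)\<^sup>2 \<le> 1"
  using rounding_error_le_1[of v z] by (simp add: abs_square_le_1)

lemma abs_bias_le_1: "\<bar>bias Q z\<bar> \<le> 1"
proof -
  have int: "integrable unif01 (\<lambda>v. rounding_error Q v z)"
    using rounding_error_le_1 by (intro unif01.integrable_const_bound[where B = 1]) auto
  have "bias Q z \<le> 1" "- 1 \<le> bias Q z"
    unfolding bias_def using rounding_error_le_1[of _ z] int
    by (intro unif01.integral_le_const unif01.integral_ge_const; simp add: abs_le_iff minus_le_iff)+
  then show ?thesis by simp
qed

lemma mse_nonneg: "0 \<le> mse Q z"
  unfolding mse_def by simp

lemma abs_mse_le_1: "\<bar>mse Q z\<bar> \<le> 1"
  using mse_nonneg[of z] mse_le_quarter[of z] by simp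

lemma abs_variance_le_1: "\<bar>mse Q z - (bias Q z)\<^sup>2\<bar> \<le> 1"
proof -
  have "(bias Q z)\<^sup>2 \<le> 1"
    using abs_bias_le_1[of z] by (simp add: abs_square_le_1)
  then show ?thesis
    using mse_nonneg[of z] mse_le_quarter[of z] zero_le_power2[of "bias Q z"] by linarith
qed

lemma integral_variance: "(\<integral>z. mse Q z - (bias Q z)\<^sup>2 \<partial>unif01) = avg_mse Q - (\<integral>z. (bias Q z)\<^sup>2 \<partial>unif01)"
proof -
  have "integrable unif01 (mse Q)" "integrable unif01 (\<lambda>z. (bias Q z)\<^sup>2)"
    using abs_mse_le_1 abs_bias_le_1
    by (intro unif01.integrable_const_bound[where B = 1]; simp add: abs_square_le_1)+
  then show ?thesis
    by (simp add: avg_mse_def)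
qed

lemma avg_mse_nonneg: "0 \<le> avg_mse Q"
  unfolding avg_mse_def by (simp add: mse_nonneg)

lemma mse_add_1: "mse Q (z + 1) = mse Q z"
  by (simp add: mse_def rounding_error_def Q_add_1)

lemma integral_mse_shift: "(\<integral>y. mse Q (y + c) \<partial>unif01) = avg_mse Q"
  unfolding avg_mse_def
  by (rule integral_unif01_shift[where B = 1]) (simp_all add: abs_mse_le_1 mse_add_1)

subsubsection \<open>Entrywise rounding\<close>

lemma expected_proxy_entrywise:
  assumes W: "W \<in> carrier_mat m n" and H: "H \<in> carrier_mat n n"
  shows "expected_proxy (entrywise Q) m H W = (\<Sum>i<m.
    quad_form n (entries H) (\<lambda>k. bias Q (W $$ (i,k))) +
    (\<Sum>k<n. H $$ (k,k) * (mse Q (W $$ (i,k)) - (bias Q (W $$ (i,k)))\<^sup>2)))"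
proof -
  let ?e = "\<lambda>i k v. rounding_error Q v (W $$ (i,k))"
  have "expected_proxy (entrywise Q) m H W =
      (\<integral>u. (\<Sum>i<m. quad_form n (entries H) (\<lambda>k. ?e i k (u (i,k)))) \<partial>unif_cube m n)"
    using H by (simp add: expected_proxy_def proxy_entrywise[OF W H])
  also have "\<dots> = (\<Sum>i<m. \<integral>u. quad_form n (entries H) (\<lambda>k. ?e i k (u (i,k))) \<partial>unif_cube m n)"
    using rounding_error_le_1
    by (intro Bochner_Integration.integral_sum unif_cube.integrable_PiM_quad_form[where B = 1])
      (auto simp: inj_on_def)
  also have "\<dots> = (\<Sum>i<m. quad_form n (entries H) (\<lambda>k. bias Q (W $$ (i,k))) +
      (\<Sum>k<n. H $$ (k,k) * (mse Q (W $$ (i,k)) - (bias Q (W $$ (i,k)))\<^sup>2)))"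
    unfolding bias_def mse_def using rounding_error_le_1
    by (intro sum.cong refl unif_cube.integral_PiM_quad_form[where B = 1]) (auto simp: inj_on_def)
  finally show ?thesis .
qed

lemma L_avg_entrywise:
  assumes H: "H \<in> carrier_mat n n"
  shows "L_avg (entrywise Q) m H = real m * avg_mse Q * mtrace H"
proof -
  let ?var = "\<lambda>z. mse Q z - (bias Q z)\<^sup>2" and ?bias2 = "\<integral>z. (bias Q z)\<^sup>2 \<partial>unif01"
  let ?quad = "\<lambda>i w. quad_form n (entries H) (\<lambda>k. bias Q (w (i,k)))"
  let ?diag = "\<lambda>i w. \<Sum>k<n. H $$ (k,k) * ?var (w (i,k))"
  have int_quad: "integrable (unif_cube m n) (?quad i)" if "i < m" for i
    using that abs_bias_le_1
    by (intro unif_cube.integrable_PiM_quad_form[where B = 1]) (auto simp: inj_on_def)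
  have int_diag: "integrable (unif_cube m n) (?diag i)" if "i < m" for i
    using that abs_variance_le_1 by (intro unif_cube.integrable_PiM_weighted_sum[where B = 1]) auto
  have "(\<integral>w. ?quad i w \<partial>unif_cube m n) = (\<Sum>k<n. H $$ (k,k) * ?bias2)" if "i < m" for i
    using that abs_bias_le_1
    by (subst unif_cube.integral_PiM_quad_form[where B = 1])
      (auto simp: inj_on_def integral_bias quad_form_def)
  moreover have "(\<integral>w. ?diag i w \<partial>unif_cube m n) = (\<Sum>k<n. H $$ (k,k) * (avg_mse Q - ?bias2))"
    if "i < m" for i
    using that abs_variance_le_1
    by (subst unif_cube.integral_PiM_weighted_sum[where B = 1]) (auto simp: integral_variance)
  ultimately have row: "(\<integral>w. ?quad i w + ?diag i w \<partial>unif_cube m n) = avg_mse Q * mtrace H"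
    if "i < m" for i
    using that H int_quad[OF that] int_diag[OF that]
    by (simp add: mtrace_def sum.distrib[symmetric] sum_distrib_left algebra_simps)
  have "L_avg (entrywise Q) m H = (\<integral>w. (\<Sum>i<m. ?quad i w + ?diag i w) \<partial>unif_cube m n)"
    using H
    by (simp add: L_avg_eq_integral_expected_proxy expected_proxy_entrywise[OF _ H] cong: quad_form_cong)
  also have "\<dots> = (\<Sum>i<m. \<integral>w. ?quad i w + ?diag i w \<partial>unif_cube m n)"
    using int_quad int_diag
    by (intro Bochner_Integration.integral_sum Bochner_Integration.integrable_add) auto
  also have "\<dots> = real m * avg_mse Q * mtrace H"
    by (simp add: row)
  finally show ?thesis .
qed

lemma L_worst_eq_mtrace:
  assumes H: "H \<in> carrier_mat n n" "sym_psd H"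
    and loss: "\<And>W. W \<in> carrier_mat m n \<Longrightarrow>
      expected_proxy A m H W = (\<Sum>i<m. \<Sum>k<n. H $$ (k,k) * mse Q (W $$ (i,k)))"
  shows "L_worst A m H = ereal (real m / 4 * mtrace H)"
proof (rule antisym)
  have trace: "(\<Sum>i<m. \<Sum>k<n. H $$ (k,k) * (1/4)) = real m / 4 * mtrace H"
    unfolding sum_diag_eq_mtrace[OF H(1)] by simp
  have diag_nonneg: "0 \<le> H $$ (k,k)" if "k < n" for k
    using H that psd_form_diag_nonneg sym_psd_iff_psd_form by blast
  show "L_worst A m H \<le> ereal (real m / 4 * mtrace H)"
  proof (rule L_worst_le[OF H(1)])
    fix W :: "real mat" assume W: "W \<in> carrier_mat m n"
    show "expected_proxy A m H W \<le> real m / 4 * mtrace H"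
      unfolding loss[OF W] trace[symmetric] using diag_nonneg mse_le_quarter
      by (intro sum_mono mult_left_mono) auto
  qed
  define W where "W = Matrix.mat m n (\<lambda>_. 1/2 :: real)"
  have W: "W \<in> carrier_mat m n" by (simp add: W_def)
  have "expected_proxy A m H W = real m / 4 * mtrace H"
    unfolding loss[OF W] trace[symmetric] by (simp add: W_def mse_half)
  then show "ereal (real m / 4 * mtrace H) \<le> L_worst A m H"
    using L_worst_ge[OF H(1) W] by metis
qed

lemma L_worst_entrywise:
  assumes H: "H \<in> carrier_mat n n" "sym_psd H" and unbiased: "\<And>z. bias Q z = 0"
  shows "L_worst (entrywise Q) m H = ereal (real m / 4 * mtrace H)"
  using H(1) by (intro L_worst_eq_mtrace[OF H])
    (simp add: expected_proxy_entrywise unbiased quad_form_def)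

subsubsection \<open>LDLQ\<close>

context
  fixes H :: "real mat" and m n :: nat and d :: "nat \<Rightarrow> real"
  assumes H: "H \<in> carrier_mat n n" and ldl: "ldl_factors n (entries H) (unit_upper (ldl_U H)) d"
begin

abbreviation feedback :: "(nat \<times> nat \<Rightarrow> real) \<Rightarrow> (nat \<times> nat \<Rightarrow> real) \<Rightarrow> nat \<Rightarrow> nat \<Rightarrow> real" where
  "feedback \<equiv> LDLQ_feedback Q (ldl_U H)"

lemma borel_measurable_feedback:
  assumes "i < m" "k < n"
  shows "(\<lambda>u. feedback w u i k) \<in> borel_measurable (unif_cube m n)"
    and "(\<lambda>w. feedback w u i k) \<in> borel_measurable (unif_cube m n)"
    and "(\<lambda>(w,u). feedback w u i k) \<in> borel_measurable (unif_cube m n \<Otimes>\<^sub>M unif_cube m n)"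
  unfolding LDLQ_feedback_def case_prod_unfold using assms
  by (auto intro!: borel_measurable_ldlq_feedback measurable_Q borel_measurable_unif_cube_component
      measurable_compose[OF measurable_fst] measurable_compose[OF measurable_snd])

lemma feedback_upd_u: "feedback w (u((i,k) := v)) i k = feedback w u i k"
  by (rule LDLQ_feedback_cong) auto

lemma feedback_upd_w: "feedback (w((i,k) := y)) u i k = feedback w u i k"
  by (rule LDLQ_feedback_cong) auto

text \<open>The feedback only depends on the randomness of earlier columns, so the randomness of the current
  step can be integrated out first.\<close>

lemma expected_proxy_LDLQ:
  assumes W: "W \<in> carrier_mat m n"
  shows "expected_proxy (LDLQ Q) m H W = (\<Sum>i<m. \<Sum>k<n.
    d k * (\<integral>u. mse Q (W $$ (i,k) + feedback (($$) W) u i k) \<partial>unif_cube m n))"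
proof -
  let ?e = "\<lambda>i k u. (rounding_error Q (u (i,k)) (W $$ (i,k) + feedback (($$) W) u i k))\<^sup>2"
  have int: "integrable (unif_cube m n) (?e i k)" if ik: "i < m" "k < n" for i k
  proof (rule unif_cube.P.integrable_const_bound[where B = 1])
    note [measurable] = borel_measurable_feedback(1)[OF ik] borel_measurable_unif_cube_component[OF ik]
    show "?e i k \<in> borel_measurable (unif_cube m n)" by measurable
  qed (simp add: rounding_error_squared_le_1)
  have step: "(\<integral>u. ?e i k u \<partial>unif_cube m n)
      = (\<integral>u. mse Q (W $$ (i,k) + feedback (($$) W) u i k) \<partial>unif_cube m n)"
    if "i < m" "k < n" for i k
    using unif_cube.integral_PiM_resample[OF _ int[OF that], of "(i,k)"] that
    by (simp add: feedback_upd_u mse_def)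
  have "expected_proxy (LDLQ Q) m H W = (\<integral>u. (\<Sum>i<m. \<Sum>k<n. d k * ?e i k u) \<partial>unif_cube m n)"
    using H by (simp add: expected_proxy_def proxy_LDLQ[OF ldl H W])
  also have "\<dots> = (\<Sum>i<m. \<Sum>k<n. d k * (\<integral>u. ?e i k u \<partial>unif_cube m n))"
    by (rule integral_double_sum_mult_right) (use int in simp)
  finally show ?thesis
    by (simp add: step)
qed

lemma expected_proxy_LDLQ_le:
  assumes W: "W \<in> carrier_mat m n"
  shows "expected_proxy (LDLQ Q) m H W \<le> real m / 4 * mtrace H"
proof -
  have "(\<integral>u. mse Q (W $$ (i,k) + feedback (($$) W) u i k) \<partial>unif_cube m n) \<le> 1/4"
    if ik: "i < m" "k < n" for i k
  proof (rule unif_cube.P.integral_le_const)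
    note [measurable] = borel_measurable_feedback(1)[OF ik]
    show "integrable (unif_cube m n) (\<lambda>u. mse Q (W $$ (i,k) + feedback (($$) W) u i k))"
      using abs_mse_le_1 by (intro unif_cube.P.integrable_const_bound[where B = 1]) auto
  qed (rule AE_I2, rule mse_le_quarter)
  then have "expected_proxy (LDLQ Q) m H W \<le> (\<Sum>i<m. \<Sum>k<n. d k * (1/4))"
    unfolding expected_proxy_LDLQ[OF W] using ldl
    by (intro sum_mono mult_left_mono) (auto simp: ldl_factors_def)
  also have "\<dots> \<le> (\<Sum>i<m. \<Sum>k<n. H $$ (k,k) * (1/4))"
    using ldl_factors_diag_le[OF ldl] by (intro sum_mono mult_right_mono) auto
  also have "\<dots> = real m / 4 * mtrace H"
    unfolding sum_diag_eq_mtrace[OF H] by simp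
  finally show ?thesis .
qed

lemma expected_proxy_LDLQ_diagonal:
  assumes W: "W \<in> carrier_mat m n" and "diagonal_mat H"
  shows "expected_proxy (LDLQ Q) m H W = (\<Sum>i<m. \<Sum>k<n. H $$ (k,k) * mse Q (W $$ (i,k)))"
proof -
  have offdiag: "H $$ (i,j) = 0" if "i < n" "j < n" "i \<noteq> j" for i j
    using assms H that by (auto simp: diagonal_mat_def)
  have "d k * (\<integral>u. mse Q (W $$ (i,k) + feedback (($$) W) u i k) \<partial>unif_cube m n)
      = H $$ (k,k) * mse Q (W $$ (i,k))" if ik: "i < m" "k < n" for i k
  proof (cases "d k = 0")
    case True
    then show ?thesis
      using ldl_factors_diagonal[OF ldl offdiag ik(2)] by simp
  next
    case False
    then have "ldl_U H $$ (j,k) = 0" if "j < k" for j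
      using ldl_factors_diagonal[OF ldl offdiag ik(2)] that by (auto simp: unit_upper_def)
    then have "feedback (($$) W) u i k = 0" for u
      unfolding LDLQ_feedback_def ldlq_feedback_def by simp
    then show ?thesis
      using ldl_factors_diagonal[OF ldl offdiag ik(2)] by (simp add: unif_cube.P.prob_space)
  qed
  then show ?thesis
    unfolding expected_proxy_LDLQ[OF W] by simp
qed

lemma integrable_mse_feedback:
  assumes ik: "i < m" "k < n"
  shows "integrable (unif_cube m n \<Otimes>\<^sub>M unif_cube m n) (\<lambda>(w,u). mse Q (w (i,k) + feedback w u i k))"
proof -
  note [measurable] = borel_measurable_feedback(3)[OF ik] borel_measurable_unif_cube_component[OF ik]
  show ?thesis
    using abs_mse_le_1 by (intro unif_cube_pair.P.integrable_const_bound[where B = 1]) auto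
qed

text \<open>Given the earlier entries of its row, the rounded number is a translate of the uniform variable
  \<open>w (i,k)\<close>, hence uniform modulo 1.\<close>

lemma integral_integral_mse_feedback:
  assumes ik: "i < m" "k < n"
  shows "(\<integral>w. (\<integral>u. mse Q (w (i,k) + feedback w u i k) \<partial>unif_cube m n) \<partial>unif_cube m n) = avg_mse Q"
proof -
  note [measurable] = borel_measurable_feedback(2)[OF ik] borel_measurable_unif_cube_component[OF ik]
  have shift: "(\<integral>w. mse Q (w (i,k) + feedback w u i k) \<partial>unif_cube m n) = avg_mse Q" for u
  proof -
    have "integrable (unif_cube m n) (\<lambda>w. mse Q (w (i,k) + feedback w u i k))"
      using abs_mse_le_1 by (intro unif_cube.P.integrable_const_bound[where B = 1]) auto
    from unif_cube.integral_PiM_resample[OF _ this, of "(i,k)"] show ?thesis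
      using ik by (simp add: feedback_upd_w integral_mse_shift unif_cube.P.prob_space)
  qed
  have "(\<integral>w. (\<integral>u. mse Q (w (i,k) + feedback w u i k) \<partial>unif_cube m n) \<partial>unif_cube m n)
      = (\<integral>u. (\<integral>w. mse Q (w (i,k) + feedback w u i k) \<partial>unif_cube m n) \<partial>unif_cube m n)"
    by (rule unif_cube_pair.Fubini_integral[symmetric]) (rule integrable_mse_feedback[OF ik])
  then show ?thesis
    by (simp add: shift unif_cube.P.prob_space)
qed

lemma L_avg_LDLQ: "L_avg (LDLQ Q) m H = real m * avg_mse Q * (\<Sum>k<n. d k)"
proof -
  let ?loss = "\<lambda>i k w. \<integral>u. mse Q (w (i,k) + feedback w u i k) \<partial>unif_cube m n"
  have feedback_mat: "feedback (($$) (Matrix.mat m n w)) u i k = feedback w u i k"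
    if "i < m" "k < n" for w u i k
    using that by (intro LDLQ_feedback_cong) auto
  have int: "integrable (unif_cube m n) (?loss i k)" if "i < m" "k < n" for i k
    using unif_cube_pair.integrable_fst[OF integrable_mse_feedback[OF that]] .
  have "L_avg (LDLQ Q) m H = (\<integral>w. (\<Sum>i<m. \<Sum>k<n. d k * ?loss i k w) \<partial>unif_cube m n)"
    using H by (simp add: L_avg_eq_integral_expected_proxy expected_proxy_LDLQ feedback_mat)
  also have "\<dots> = (\<Sum>i<m. \<Sum>k<n. d k * (\<integral>w. ?loss i k w \<partial>unif_cube m n))"
    by (rule integral_double_sum_mult_right) (use int in simp)
  also have "\<dots> = real m * avg_mse Q * (\<Sum>k<n. d k)"
    by (simp add: integral_integral_mse_feedback sum_distrib_left mult_ac)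
  finally show ?thesis .
qed

end

lemma SUP_L_worst_LDLQ:
  assumes H: "H \<in> carrier_mat n n" "sym_psd H"
  shows "(SUP Ht\<in>same_spectrum_psd H. L_worst (LDLQ Q) m Ht) = ereal (real m / 4 * mtrace H)"
proof (rule SUP_same_spectrum_psd[OF H])
  fix Ht assume Ht: "Ht \<in> carrier_mat n n" "sym_psd Ht"
  obtain d where d: "ldl_factors n (entries Ht) (unit_upper (ldl_U Ht)) d"
    using sym_psd_ldl_U[OF Ht] .
  show "L_worst (LDLQ Q) m Ht \<le> ereal (real m / 4 * mtrace Ht)"
    by (rule L_worst_le[OF Ht(1)]) (rule expected_proxy_LDLQ_le[OF Ht(1) d])
  assume "diagonal_mat Ht"
  then show "L_worst (LDLQ Q) m Ht = ereal (real m / 4 * mtrace Ht)"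
    by (intro L_worst_eq_mtrace[OF Ht] expected_proxy_LDLQ_diagonal[OF Ht(1) d])
qed

lemma SUP_L_avg_LDLQ:
  assumes H: "H \<in> carrier_mat n n" "sym_psd H"
  shows "(SUP Ht\<in>same_spectrum_psd H. ereal (L_avg (LDLQ Q) m Ht))
    = ereal (real m * avg_mse Q * mtrace H)"
proof (rule SUP_same_spectrum_psd[OF H])
  fix Ht assume Ht: "Ht \<in> carrier_mat n n" "sym_psd Ht"
  obtain d where d: "ldl_factors n (entries Ht) (unit_upper (ldl_U Ht)) d"
    using sym_psd_ldl_U[OF Ht] .
  have "(\<Sum>k<n. d k) \<le> mtrace Ht"
    using Ht(1) ldl_factors_diag_le[OF d] by (auto simp: mtrace_def intro!: sum_mono)
  then show "ereal (L_avg (LDLQ Q) m Ht) \<le> ereal (real m * avg_mse Q * mtrace Ht)"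
    unfolding L_avg_LDLQ[OF Ht(1) d] using avg_mse_nonneg by (simp add: mult_left_mono)
  assume "diagonal_mat Ht"
  then have "Ht $$ (i,j) = 0" if "i < n" "j < n" "i \<noteq> j" for i j
    using Ht(1) that by (auto simp: diagonal_mat_def)
  from ldl_factors_diagonal[OF d this] have "(\<Sum>k<n. d k) = mtrace Ht"
    using Ht(1) by (simp add: mtrace_def)
  then show "ereal (L_avg (LDLQ Q) m Ht) = ereal (real m * avg_mse Q * mtrace Ht)"
    by (simp add: L_avg_LDLQ[OF Ht(1) d])
qed

end

subsection \<open>Nearest rounding\<close>

lemma near_round_borel_measurable [measurable]: "near_round v \<in> borel_measurable borel"
  unfolding near_round_def by measurable

lemma near_rounding_error_add_1: "rounding_error near_round v (z + 1) = rounding_error near_round v z"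
proof -
  have "\<lfloor>z + 1 + 1/2\<rfloor> = \<lfloor>z + 1/2\<rfloor> + 1" by linarith
  then show ?thesis
    by (simp add: rounding_error_def near_round_def)
qed

lemma abs_near_rounding_error_le: "\<bar>rounding_error near_round v z\<bar> \<le> 1/2"
  unfolding rounding_error_def near_round_def by linarith

lemma near_rounding_error_eq_uminus: "-1/2 < z \<Longrightarrow> z < 1/2 \<Longrightarrow> rounding_error near_round v z = - z"
  unfolding rounding_error_def near_round_def by (simp add: floor_eq_iff)

lemma bias_near_round: "bias near_round z = rounding_error near_round 0 z"
  by (simp add: bias_def rounding_error_def near_round_def)

lemma mse_near_round: "mse near_round z = (rounding_error near_round 0 z)\<^sup>2"
  by (simp add: mse_def rounding_error_def near_round_def)

lemma integral_near_rounding_error: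
  fixes f :: "real \<Rightarrow> real"
  assumes [measurable]: "f \<in> borel_measurable borel" and bounded: "\<And>x. \<bar>x\<bar> \<le> 1/2 \<Longrightarrow> \<bar>f x\<bar> \<le> B"
  shows "(\<integral>z. f (rounding_error near_round v z) \<partial>unif01) = (LBINT z=(-1/2::real)..(1/2::real). f (- z))"
proof -
  have "(\<integral>z. f (rounding_error near_round v z) \<partial>unif01)
      = (LBINT z=(-1/2::real)..(-1/2::real)+1. f (rounding_error near_round v z))"
  proof (rule integral_unif01_periodic[where B = B])
    show "(\<lambda>z. f (rounding_error near_round v z)) \<in> borel_measurable borel"
      unfolding rounding_error_def by measurable
  qed (use bounded abs_near_rounding_error_le near_rounding_error_add_1 in auto)
  also have "\<dots> = (LBINT z=(-1/2::real)..(1/2::real). f (- z))"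
    by (simp, intro interval_integral_cong) (auto simp: einterval_iff near_rounding_error_eq_uminus)
  finally show ?thesis .
qed

lemma integral_bias_near_round: "(\<integral>z. bias near_round z \<partial>unif01) = 0"
proof -
  have "(\<integral>z. bias near_round z \<partial>unif01) = (LBINT z=(-1/2::real)..(1/2::real). - z)"
    unfolding bias_near_round by (rule integral_near_rounding_error[where B = "1/2"]) simp_all
  also have "\<dots> = - ((1/2)\<^sup>2 / 2) - (- ((-1/2)\<^sup>2 / 2))"
    by (rule interval_integral_FTC_finite[where F = "\<lambda>z. - (z\<^sup>2 / 2)"])
      (auto intro!: continuous_intros derivative_eq_intros
        simp flip: has_real_derivative_iff_has_vector_derivative)
  finally show ?thesis
    by (simp add: power2_eq_square)
qed

lemma avg_mse_near_round: "avg_mse near_round = 1/12"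
proof -
  have "avg_mse near_round = (LBINT z=(-1/2::real)..(1/2::real). (- z)\<^sup>2)"
    unfolding avg_mse_def mse_near_round
    by (rule integral_near_rounding_error[where B = 1]) (simp_all add: abs_square_le_1)
  also have "\<dots> = (1/2)^3 / 3 - (-1/2)^3 / 3"
    by (rule interval_integral_FTC_finite[where F = "\<lambda>z. z^3 / 3"])
      (auto intro!: continuous_intros derivative_eq_intros
        simp flip: has_real_derivative_iff_has_vector_derivative)
  finally show ?thesis
    by (simp add: power3_eq_cube)
qed

interpretation near: rounding near_round
proof
  show "(\<lambda>(v,z). near_round v z) \<in> borel_measurable (borel \<Otimes>\<^sub>M borel)"
    unfolding near_round_def by measurable
  show "near_round v (z + 1) = near_round v z + 1" for v z
    using near_rounding_error_add_1[of v z] by (simp add: rounding_error_def)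
  show "\<bar>rounding_error near_round v z\<bar> \<le> 1" for v z
    using abs_near_rounding_error_le[of v z] by simp
  show "mse near_round z \<le> 1/4" for z
    using power_mono[OF abs_near_rounding_error_le[of 0 z] abs_ge_zero, of 2]
    by (simp add: mse_near_round power2_eq_square)
  show "mse near_round (1/2) = 1/4"
    by (simp add: mse_near_round rounding_error_def near_round_def power2_eq_square)
qed (rule integral_bias_near_round)

subsection \<open>Stochastic rounding\<close>

lemma stoch_rounding_error: "rounding_error stoch_round v z = indicator {..<frac z} v - frac z"
  by (auto simp: rounding_error_def stoch_round_def frac_def indicator_def)

lemma integral_unif01_indicator:
  assumes "0 \<le> b" "b \<le> 1"
  shows "(\<integral>v. indicat_real {..<b} v \<partial>unif01) = b"
proof -
  have "{0..1} \<inter> {..<b} = {0..<b}"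
    using assms by auto
  then show ?thesis
    using assms by (simp add: unif01_def)
qed

lemma integrable_unif01_indicator: "integrable unif01 (indicat_real {..<b})"
  by (intro unif01.integrable_const_bound[where B = 1]) auto

lemma bias_stoch_round: "bias stoch_round z = 0"
  unfolding bias_def stoch_rounding_error
  using integral_unif01_indicator[of "frac z"] integrable_unif01_indicator[of "frac z"]
    frac_lt_1[of z]
  by simp

lemma mse_stoch_round: "mse stoch_round z = frac z * (1 - frac z)"
proof -
  have "(rounding_error stoch_round v z)\<^sup>2
      = (1 - 2 * frac z) * indicator {..<frac z} v + (frac z)\<^sup>2" for v
    unfolding stoch_rounding_error by (auto simp: indicator_def power2_eq_square algebra_simps)
  then have "mse stoch_round z = (\<integral>v. (1 - 2 * frac z) * indicator {..<frac z} v + (frac z)\<^sup>2 \<partial>unif01)"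
    by (simp only: mse_def)
  also have "\<dots> = frac z * (1 - frac z)"
    using integral_unif01_indicator[of "frac z"] integrable_unif01_indicator[of "frac z"]
    frac_lt_1[of z]
    by (simp add: power2_eq_square algebra_simps)
  finally show ?thesis .
qed

lemma avg_mse_stoch_round: "avg_mse stoch_round = 1/6"
proof -
  have [measurable]: "(frac :: real \<Rightarrow> real) \<in> borel_measurable borel"
    unfolding frac_def by measurable
  have "avg_mse stoch_round = (\<integral>z. z * (1 - z) \<partial>unif01)"
    unfolding avg_mse_def mse_stoch_round
    by (intro integral_unif01_cong) (auto simp: frac_eq[THEN iffD2])
  also have "\<dots> = (LBINT z=(0::real)..(1::real). z * (1 - z))"
    by (subst integral_unif01) (simp_all add: zero_ereal_def one_ereal_def)
  also have "\<dots> = (1\<^sup>2 / 2 - 1^3 / 3) - (0\<^sup>2 / 2 - 0^3 / 3)"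
    by (rule interval_integral_FTC_finite[where F = "\<lambda>z. z\<^sup>2 / 2 - z^3 / 3"])
      (auto intro!: continuous_intros derivative_eq_intros
        simp: power2_eq_square algebra_simps simp flip: has_real_derivative_iff_has_vector_derivative)
  finally show ?thesis by simp
qed

interpretation stoch: rounding stoch_round
proof
  show "(\<lambda>(v,z). stoch_round v z) \<in> borel_measurable (borel \<Otimes>\<^sub>M borel)"
    unfolding stoch_round_def by measurable
  show "stoch_round v (z + 1) = stoch_round v z + 1" for v z
    by (simp add: stoch_round_def)
  show "\<bar>rounding_error stoch_round v z\<bar> \<le> 1" for v z
    unfolding stoch_rounding_error using frac_ge_0[of z] frac_lt_1[of z] by (auto simp: indicator_def)
  show "mse stoch_round z \<le> 1/4" for z
    using zero_le_power2[of "frac z - 1/2"]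
    by (simp add: mse_stoch_round power2_eq_square algebra_simps)
  show "mse stoch_round (1/2) = 1/4"
    by (simp add: mse_stoch_round frac_eq[THEN iffD2])
qed (simp add: bias_stoch_round)

theorem theorem4:
  fixes m n :: nat and H :: "real mat"
  assumes "H \<in> carrier_mat n n" and "sym_psd H"
  shows
    "(SUP Ht \<in> same_spectrum_psd H. L_worst (LDLQ near_round) m Ht) = L_worst (entrywise stoch_round) m H
     \<and> (SUP Ht \<in> same_spectrum_psd H. L_worst (LDLQ stoch_round) m Ht) = L_worst (entrywise stoch_round) m H
     \<and> L_worst (entrywise stoch_round) m H = ereal (real m / 4 * mtrace H)
     \<and> (SUP Ht \<in> same_spectrum_psd H. ereal (L_avg (LDLQ near_round) m Ht)) = ereal (L_avg (entrywise near_round) m H)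
     \<and> L_avg (entrywise near_round) m H = real m / 12 * mtrace H
     \<and> (SUP Ht \<in> same_spectrum_psd H. ereal (L_avg (LDLQ stoch_round) m Ht)) = ereal (L_avg (entrywise stoch_round) m H)
     \<and> L_avg (entrywise stoch_round) m H = real m / 6 * mtrace H"
  using near.SUP_L_worst_LDLQ[OF assms] stoch.SUP_L_worst_LDLQ[OF assms]
    stoch.L_worst_entrywise[OF assms bias_stoch_round]
    near.SUP_L_avg_LDLQ[OF assms] stoch.SUP_L_avg_LDLQ[OF assms]
    near.L_avg_entrywise[OF assms(1)] stoch.L_avg_entrywise[OF assms(1)]
  by (simp add: avg_mse_near_round avg_mse_stoch_round)

end
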